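(* Let $\alpha>0$ and let $\Delta$ and $d$ be positive integers, all fixed (independent of $n$). For each sufficiently large $n$ let $H=H_n\in\mathcal H(n,\Delta,d)$ be a graph with at least one edge, let $c=\lceil(1+\alpha)|E(H)|\rceil$, and let $p=p(n)\in[0,1]$ satisfy $p\ge n^{-1/d}\log^{5/d}n$. Then $G\sim\mathcal G_c(n,p)$ with high probability contains a rainbow copy of $H$, i.e. the probability of this event tends to $1$ as $n\to\infty$.
   Context: All graphs are finite and simple. The maximum density of a graph $G$ is $d(G)=\max\{2|E(H)|/|V(H)| : H\subseteq G\}$, the maximum being over subgraphs $H$ with at least one vertex. $\mathcal H(n,\Delta,d)$ is the family of all graphs on $n$ vertices with maximum degree at most $\Delta$ and maximum density at most $d$. $\mathcal G(n,p)$ is the random graph on $n$ vertices in which each pair of vertices forms an edge independently with probability $p$. $\mathcal G_c(n,p)$ is the random edge-colored graph obtained by sampling $G\sim\mathcal G(n,p)$ and coloring each edge of $G$ independently and uniformly at random with a color from $[c]=\{1,\dots,c\}$. A rainbow copy of $H$ in $G$ is a (not necessarily induced) subgraph of $G$ isomorphic to $H$ all of whose edges have pairwise distinct colors. $\log$ is the natural logarithm. *)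

theory Defs
  imports "HOL-Probability.Probability"
begin

text \<open>A graph is a pair of a vertex set and a set of edges, the edges being two-element
  sets of vertices.\<close>

type_synonym 'a graph = "'a set \<times> 'a set set"

abbreviation verts :: "'a graph \<Rightarrow> 'a set" where
  "verts G \<equiv> fst G"

abbreviation edges :: "'a graph \<Rightarrow> 'a set set" where
  "edges G \<equiv> snd G"

definition simple_graph :: "'a graph \<Rightarrow> bool" where
  "simple_graph G \<longleftrightarrow> finite (verts G) \<and> (\<forall>e\<in>edges G. e \<subseteq> verts G \<and> card e = 2)"

definition subgraph :: "'a graph \<Rightarrow> 'a graph \<Rightarrow> bool" where
  "subgraph K G \<longleftrightarrow> simple_graph K \<and> verts K \<subseteq> verts G \<and> edges K \<subseteq> edges G"

definition isomorphic :: "'a graph \<Rightarrow> 'b graph \<Rightarrow> bool" where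
  "isomorphic G G' \<longleftrightarrow>
    (\<exists>f. bij_betw f (verts G) (verts G') \<and> edges G' = (\<lambda>e. f ` e) ` edges G)"

definition degree :: "'a graph \<Rightarrow> 'a \<Rightarrow> nat" where
  "degree G v = card {e \<in> edges G. v \<in> e}"

text \<open>The two maxima below are meaningful only for finite graphs with at least one vertex.\<close>

definition max_degree :: "'a graph \<Rightarrow> nat" where
  "max_degree G = Max (degree G ` verts G)"

definition max_density :: "'a graph \<Rightarrow> real" where
  "max_density G =
    Max {2 * real (card (edges K)) / real (card (verts K)) | K. subgraph K G \<and> verts K \<noteq> {}}"

definition graph_family :: "nat \<Rightarrow> nat \<Rightarrow> real \<Rightarrow> 'a graph set" where
  "graph_family n \<Delta> d =
    {H. simple_graph H \<and> card (verts H) = n \<and> max_degree H \<le> \<Delta> \<and> max_density H \<le> d}"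

definition vertex_pairs :: "nat \<Rightarrow> nat set set" where
  "vertex_pairs n = {e. e \<subseteq> {1..n} \<and> card e = 2}"

definition random_graph :: "nat \<Rightarrow> real \<Rightarrow> nat graph pmf" where
  "random_graph n p =
    map_pmf (\<lambda>X. ({1..n}, {e \<in> vertex_pairs n. X e}))
      (Pi_pmf (vertex_pairs n) False (\<lambda>_. bernoulli_pmf p))"

text \<open>An outcome is a graph together with a colouring; the colouring takes the dummy value
  0 outside the edge set. The number of colours has to be positive.\<close>

definition random_colored_graph ::
    "nat \<Rightarrow> nat \<Rightarrow> real \<Rightarrow> (nat graph \<times> (nat set \<Rightarrow> nat)) pmf" where
  "random_colored_graph c n p =
    bind_pmf (random_graph n p) (\<lambda>G.
      map_pmf (\<lambda>col. (G, col)) (Pi_pmf (edges G) 0 (\<lambda>_. pmf_of_set {1..c})))"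

definition contains_rainbow_copy :: "'a graph \<Rightarrow> 'b graph \<times> ('b set \<Rightarrow> 'c) \<Rightarrow> bool" where
  "contains_rainbow_copy H GC \<longleftrightarrow>
    (\<exists>K. subgraph K (fst GC) \<and> isomorphic H K \<and> inj_on (snd GC) (edges K))"

end

theory Submission
  imports Defs "HOL-Real_Asymp.Real_Asymp"
begin

text \<open>The method is that of Park and Pham for the Kahn--Kalai conjecture, applied to a spread
  measure. The uniform measure on the rainbow copies of \<open>H\<close>, regarded as
  sets of coloured edges, is spread: a fixed set of \<open>k\<close> coloured edges is contained in a random
  copy with probability at most \<open>\<theta>\<^sup>k\<close>, where \<open>\<theta>\<close> is of order \<open>n\<^sup>-\<^sup>x / c\<close> with \<open>x = 1\<close> for
  \<open>d = 1\<close> and \<open>x = 4/(3d)\<close> for \<open>d \<ge> 2\<close>; this follows by passing to a spanning forest. Exposing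
  \<open>O(log n)\<close> independent random sets of coloured edges, each of which halves the size of what is
  still missing from a minimal fragment, then produces a rainbow copy. Since a rainbow copy uses
  each edge with one colour only, independent colours may finally be replaced by a single random
  colour.\<close>

section \<open>Spread families and random sets\<close>

text \<open>Vertices of a copy are counted one at a time, so an edge gains a factor of order 1/n
  only when it reaches a new vertex; an edge closing a cycle gains nothing. Hence edge sets are
  measured by a spanning forest, and the density, which bounds edges against forest edges, decides
  the exponent \<open>x\<close>. Spread need not pass from a family to its fragments. What does pass
  on, up to the cost of the large fragments, is a consequence of it: every collection
  \<open>\<U>\<close> such that each member contains some \<open>T\<close> in \<open>\<U>\<close>
  has total cost, the sum of \<open>\<theta> ^ card T\<close>, at least 1. A round of density
  \<open>L * \<theta>\<close> loses at most \<open>4 / L\<close>, so for \<open>m\<close> rounds,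
  \<open>m\<close> of order log n, \<open>L\<close> has to outgrow \<open>m\<close>. The factor
  \<open>1 / c\<close> of the total density \<open>m * L * \<theta>\<close> is matched by the
  probability \<open>p / c\<close> of a coloured edge. There remains n^(-x) against n^(-1/d): a
  polynomial gain if d >= 2, while for d = 1 the powers of log n in the bound on \<open>p\<close>
  have to pay.\<close>

text \<open>Expectation over a \<open>q\<close>-random subset, as a finite sum: the recursion over
  \<open>X\<close> and exchanges of expectations become plain algebra, valid for every real
  \<open>q\<close>.\<close>

definition bin_expect :: "real \<Rightarrow> 'x set \<Rightarrow> ('x set \<Rightarrow> real) \<Rightarrow> real" where
  "bin_expect q X g = (\<Sum>W\<in>Pow X. q ^ card W * (1 - q) ^ card (X - W) * g W)"

lemma bin_expect_empty [simp]: "bin_expect q {} g = g {}"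
  by (simp add: bin_expect_def)

lemma bin_expect_insert:
  assumes "finite X" "x \<notin> X"
  shows "bin_expect q (insert x X) g =
    (1 - q) * bin_expect q X g + q * bin_expect q X (\<lambda>W. g (insert x W))"
proof -
  let ?w = "\<lambda>W. q ^ card W * (1 - q) ^ card (insert x X - W) * g W"
  have "bin_expect q (insert x X) g = sum ?w (Pow X) + sum ?w (insert x ` Pow X)"
    unfolding bin_expect_def Pow_insert using assms by (intro sum.union_disjoint) auto
  moreover have "sum ?w (Pow X) = (1 - q) * bin_expect q X g"
    unfolding bin_expect_def sum_distrib_left
  proof (rule sum.cong)
    fix W assume "W \<in> Pow X"
    then have "insert x X - W = insert x (X - W)" "x \<notin> X - W" using assms by auto
    then show "?w W = (1 - q) * (q ^ card W * (1 - q) ^ card (X - W) * g W)"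
      using assms by simp
  qed simp
  moreover have "sum ?w (insert x ` Pow X) = q * bin_expect q X (\<lambda>W. g (insert x W))"
  proof -
    have "inj_on (insert x) (Pow X)"
      by (rule inj_onI) (metis Diff_insert_absorb PowD assms(2) subset_iff)
    then have "sum ?w (insert x ` Pow X) = (\<Sum>W\<in>Pow X. ?w (insert x W))"
      by (simp add: sum.reindex)
    also have "\<dots> = (\<Sum>W\<in>Pow X. q * (q ^ card W * (1 - q) ^ card (X - W) * g (insert x W)))"
    proof (rule sum.cong)
      fix W assume W: "W \<in> Pow X"
      then have "insert x X - insert x W = X - W" "x \<notin> W" "finite W"
        using assms finite_subset by auto
      then show "?w (insert x W) = q * (q ^ card W * (1 - q) ^ card (X - W) * g (insert x W))"
        by simp
    qed simp
    finally show ?thesis by (simp add: bin_expect_def sum_distrib_left)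
  qed
  ultimately show ?thesis by simp
qed

lemma bin_expect_const: "finite X \<Longrightarrow> bin_expect q X (\<lambda>_. a) = a"
  by (induction X rule: finite_induct) (auto simp: bin_expect_insert algebra_simps)

lemma bin_expect_mono:
  assumes "0 \<le> q" "q \<le> 1" "\<And>W. W \<subseteq> X \<Longrightarrow> g W \<le> h W"
  shows "bin_expect q X g \<le> bin_expect q X h"
  unfolding bin_expect_def using assms by (intro sum_mono mult_left_mono) auto

lemma bin_expect_cong:
  "(\<And>W. W \<subseteq> X \<Longrightarrow> g W = h W) \<Longrightarrow> bin_expect q X g = bin_expect q X h"
  unfolding bin_expect_def by (intro sum.cong) auto

lemma bin_expect_add:
  "bin_expect q X (\<lambda>W. g W + h W) = bin_expect q X g + bin_expect q X h"
  by (simp add: bin_expect_def algebra_simps sum.distrib)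

lemma bin_expect_cmult:
  "bin_expect q X (\<lambda>W. a * g W) = a * bin_expect q X g"
  by (simp add: bin_expect_def sum_distrib_left algebra_simps)

lemma bin_expect_sum:
  "bin_expect q X (\<lambda>W. \<Sum>j\<in>J. g j W) = (\<Sum>j\<in>J. bin_expect q X (g j))"
  unfolding bin_expect_def sum_distrib_left by (rule sum.swap)

lemma bin_expect_union:
  assumes "finite X" "finite Y" "X \<inter> Y = {}"
  shows "bin_expect q (X \<union> Y) g = bin_expect q X (\<lambda>U. bin_expect q Y (\<lambda>B. g (U \<union> B)))"
  using assms
proof (induction X arbitrary: g rule: finite_induct)
  case (insert x X)
  then have "bin_expect q (insert x (X \<union> Y)) g =
    (1 - q) * bin_expect q (X \<union> Y) g + q * bin_expect q (X \<union> Y) (\<lambda>W. g (insert x W))"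
    by (intro bin_expect_insert) auto
  then show ?case using insert by (simp add: bin_expect_insert)
qed simp

text \<open>An element is missed by the union exactly when both independent rounds miss it. The
  induction treats one element at a time; once \<open>x\<close> is drawn in the first round, the
  second draw at \<open>x\<close> changes nothing.\<close>

lemma bin_expect_two_rounds:
  assumes "finite X"
  shows "bin_expect q X (\<lambda>W. bin_expect q' X (\<lambda>W'. g (W \<union> W'))) =
    bin_expect (1 - (1 - q) * (1 - q')) X g"
  using assms
proof (induction X arbitrary: g rule: finite_induct)
  case (insert x X)
  have *: "bin_expect q' (insert x X) (\<lambda>W'. g (W \<union> W')) =
      (1 - q') * bin_expect q' X (\<lambda>W'. g (W \<union> W')) +
      q' * bin_expect q' X (\<lambda>W'. g (insert x (W \<union> W')))" for W
    using insert by (simp add: bin_expect_insert)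
  have **: "bin_expect q' (insert x X) (\<lambda>W'. g (insert x W \<union> W')) =
      bin_expect q' X (\<lambda>W'. g (insert x (W \<union> W')))" for W
    using insert by (simp add: bin_expect_insert algebra_simps)
  have "bin_expect q (insert x X) (\<lambda>W. bin_expect q' (insert x X) (\<lambda>W'. g (W \<union> W'))) =
    (1 - q) * bin_expect q X (\<lambda>W. bin_expect q' (insert x X) (\<lambda>W'. g (W \<union> W')))
    + q * bin_expect q X (\<lambda>W. bin_expect q' (insert x X) (\<lambda>W'. g (insert x W \<union> W')))"
    using insert.hyps by (rule bin_expect_insert)
  also have "\<dots> = (1 - q) * ((1 - q') * bin_expect (1 - (1 - q) * (1 - q')) X g
      + q' * bin_expect (1 - (1 - q) * (1 - q')) X (\<lambda>W. g (insert x W)))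
    + q * bin_expect (1 - (1 - q) * (1 - q')) X (\<lambda>W. g (insert x W))"
    unfolding ** unfolding * bin_expect_add bin_expect_cmult insert.IH
      insert.IH[of "\<lambda>W. g (insert x W)"] by (rule refl)
  also have "\<dots> = bin_expect (1 - (1 - q) * (1 - q')) (insert x X) g"
    unfolding bin_expect_insert[OF insert.hyps] by (simp add: algebra_simps)
  finally show ?case .
qed simp

text \<open>\<open>miss_prob q X m \<H>\<close> is the probability that no member of \<open>\<H>\<close> is contained in the
  union of \<open>m\<close> independent \<open>q\<close>-random subsets of \<open>X\<close>.\<close>

primrec miss_prob :: "real \<Rightarrow> 'x set \<Rightarrow> nat \<Rightarrow> 'x set set \<Rightarrow> real" where
  "miss_prob q X 0 \<H> = (if {} \<in> \<H> then 0 else 1)"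
| "miss_prob q X (Suc m) \<H> = bin_expect q X (\<lambda>W. miss_prob q X m ((\<lambda>S. S - W) ` \<H>))"

lemma miss_prob_bounds:
  assumes "finite X" "0 \<le> q" "q \<le> 1"
  shows "0 \<le> miss_prob q X m \<H> \<and> miss_prob q X m \<H> \<le> 1"
proof (induction m arbitrary: \<H>)
  case (Suc m)
  have "bin_expect q X (\<lambda>_. 0) \<le> miss_prob q X (Suc m) \<H>"
    "miss_prob q X (Suc m) \<H> \<le> bin_expect q X (\<lambda>_. 1)"
    unfolding miss_prob.simps using assms Suc by (auto intro!: bin_expect_mono)
  then show ?case using assms(1) by (simp add: bin_expect_const)
qed simp

lemma miss_prob_antimono:
  assumes "0 \<le> q" "q \<le> 1" "\<H>' \<subseteq> \<H>"
  shows "miss_prob q X m \<H> \<le> miss_prob q X m \<H>'"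
  using assms(3)
proof (induction m arbitrary: \<H> \<H>')
  case (Suc m)
  show ?case unfolding miss_prob.simps
    using Suc assms by (intro bin_expect_mono Suc.IH image_mono) auto
qed auto

text \<open>The rounds merge because \<open>S - W\<close> lies in \<open>W'\<close> exactly when
  \<open>S\<close> lies in \<open>W \<union> W'\<close>. Zero rounds amount to density 0, where only
  the empty set is drawn.\<close>

lemma miss_prob_eq:
  assumes "finite X"
  shows "miss_prob q X m \<H> =
    bin_expect (1 - (1 - q) ^ m) X (\<lambda>W. if \<exists>S\<in>\<H>. S \<subseteq> W then 0 else 1)"
proof (induction m arbitrary: \<H>)
  case 0
  have "bin_expect 0 X g = g {}" for g :: "'a set \<Rightarrow> real"
    using assms by (induction X rule: finite_induct) (auto simp: bin_expect_insert)
  then show ?case by (auto intro: bexI[of _ "{}"])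
next
  case (Suc m)
  have "(\<exists>S\<in>(\<lambda>S. S - W) ` \<H>. S \<subseteq> W') \<longleftrightarrow> (\<exists>S\<in>\<H>. S \<subseteq> W \<union> W')" for W W'
    by auto
  then show ?case
    using bin_expect_two_rounds[OF assms, of q "1 - (1 - q) ^ m"] Suc by simp
qed

section \<open>Minimal fragments and the cost of covers\<close>

text \<open>Minimality is by inclusion; cardinality only decides later which fragments count as
  large.\<close>

definition min_fragments :: "'x set set \<Rightarrow> 'x set \<Rightarrow> 'x set set" where
  "min_fragments \<H> W = {T \<in> (\<lambda>S. S - W) ` \<H>. \<forall>S\<in>\<H>. S - W \<subseteq> T \<longrightarrow> S - W = T}"

text \<open>Among the sets \<open>S' - W\<close> inside \<open>S\<close>, one of least cardinality
  is minimal by inclusion. Consequently a cover of the minimal fragments is also a cover of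
  \<open>\<H>\<close>.\<close>

lemma min_fragments_cover:
  assumes "finite S" "S \<in> \<H>"
  shows "\<exists>T\<in>min_fragments \<H> W. T \<subseteq> S"
proof -
  let ?P = "\<lambda>R. R \<in> (\<lambda>S. S - W) ` \<H> \<and> R \<subseteq> S"
  have "?P (S - W)" using assms by auto
  then obtain T where T: "?P T" "\<And>R. ?P R \<Longrightarrow> card T \<le> card R"
    using exists_least_iff[of "\<lambda>k. \<exists>R. ?P R \<and> card R = k"]
    by (metis (mono_tags, lifting) linorder_not_less)
  have "S' - W = T" if "S' \<in> \<H>" "S' - W \<subseteq> T" for S'
  proof -
    have "?P (S' - W)" using that T(1) by auto
    then have "card T \<le> card (S' - W)" by (rule T(2))
    then show ?thesis using that(2) T(1) assms(1)
      by (metis card_seteq finite_subset)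
  qed
  then have "T \<in> min_fragments \<H> W" using T(1) by (simp add: min_fragments_def)
  then show ?thesis using T(1) by auto
qed

text \<open>The key step of Park and Pham. If \<open>T\<close> is a minimal fragment for \<open>W\<close> then \<open>T\<close> is contained
  in every member of \<open>\<H>\<close> lying inside \<open>W \<union> T\<close>, so that \<open>W \<union> T\<close> leaves only few
  possibilities for \<open>T\<close>.\<close>

lemma large_fragments_cost:
  fixes X :: "'x set" and q L \<theta> :: real
  assumes X: "finite X" "\<H> \<subseteq> Pow X" "\<And>S. S \<in> \<H> \<Longrightarrow> card S \<le> l"
    and q: "q = L * \<theta>" "q \<le> 1" "\<theta> > 0" "L \<ge> 4"
  shows "bin_expect q X (\<lambda>W. \<Sum>T\<in>{T\<in>min_fragments \<H> W. card T > l div 2}. \<theta> ^ card T) \<le> 4 / L"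
proof -
  define k where "k = l div 2"
  define \<U> where "\<U> W = {T\<in>min_fragments \<H> W. card T > k}" for W
  define wt where "wt W = q ^ card W * (1 - q) ^ card (X - W)" for W
  \<comment> \<open>The member inside \<open>Z\<close> is chosen from \<open>Z\<close> alone,
    without knowledge of \<open>W\<close> or \<open>T\<close>; the candidates for \<open>T\<close>
    are then among its at most \<open>2 ^ l\<close> subsets.\<close>
  define \<V> where "\<V> Z = (if \<exists>S\<in>\<H>. S \<subseteq> Z
     then {T. T \<subseteq> (SOME S. S \<in> \<H> \<and> S \<subseteq> Z) \<and> card T > k} else {})" for Z
  have q0: "q > 0" using q by simp
  have wt_nonneg: "wt W \<ge> 0" for W using q0 q by (simp add: wt_def)
  have \<U>D: "T \<subseteq> X \<and> T \<inter> W = {} \<and> T \<in> \<V> (W \<union> T)" if TU: "T \<in> \<U> W" for T W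
  proof -
    obtain S where S: "S \<in> \<H>" "T = S - W"
      using TU unfolding \<U>_def min_fragments_def by blast
    have min: "S - W = T" if "S \<in> \<H>" "S - W \<subseteq> T" for S
      using that TU unfolding \<U>_def min_fragments_def by blast
    have c: "card T > k" using TU by (simp add: \<U>_def)
    have ex: "\<exists>S. S \<in> \<H> \<and> S \<subseteq> W \<union> T" using S by blast
    define S' where "S' = (SOME S. S \<in> \<H> \<and> S \<subseteq> W \<union> T)"
    have S': "S' \<in> \<H>" "S' \<subseteq> W \<union> T" using someI_ex[OF ex] by (auto simp: S'_def)
    then have "S' - W = T" by (intro min) auto
    then have "T \<subseteq> S'" by auto
    then have "T \<in> \<V> (W \<union> T)" using ex c by (auto simp: \<V>_def S'_def)
    then show ?thesis using S X by auto
  qed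
  have fin\<U>: "finite (\<U> W)" for W
    by (rule finite_subset[of _ "Pow X"]) (use \<U>D X in auto)
  have \<V>_subset: "\<exists>S\<in>\<H>. \<V> Z \<subseteq> {T \<in> Pow S. card T > k}" if "\<V> Z \<noteq> {}" for Z
  proof -
    from that have ex: "\<exists>S. S \<in> \<H> \<and> S \<subseteq> Z" by (auto simp: \<V>_def split: if_splits)
    show ?thesis
      by (rule bexI[of _ "SOME S. S \<in> \<H> \<and> S \<subseteq> Z"])
        (use someI_ex[OF ex] in \<open>auto simp: \<V>_def split: if_splits\<close>)
  qed
  have \<V>_cost: "finite (\<V> Z) \<and> (\<Sum>T\<in>\<V> Z. (1 / L) ^ card T) \<le> 4 / L" for Z
  proof (cases "\<V> Z = {}")
    case False
    from \<V>_subset[OF this] obtain S where S: "S \<in> \<H>" "\<V> Z \<subseteq> {T \<in> Pow S. card T > k}"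
      by blast
    have "S \<subseteq> X" using S(1) X(2) by blast
    then have finS: "finite S" using X(1) by (rule finite_subset)
    have cS: "card S \<le> l" using S(1) by (rule X(3))
    have "(\<Sum>T\<in>\<V> Z. (1 / L) ^ card T) \<le> (\<Sum>T\<in>\<V> Z. (1 / L) ^ (k + 1))"
      using S q by (intro sum_mono power_decreasing) auto
    also have "\<dots> = card (\<V> Z) * (1 / L) ^ (k + 1)" by simp
    also have "\<dots> \<le> 2 ^ l * (1 / L) ^ (k + 1)"
    proof (rule mult_right_mono)
      have "card (\<V> Z) \<le> card (Pow S)" using S finS by (intro card_mono) auto
      also have "\<dots> \<le> 2 ^ l" using finS cS by (simp add: card_Pow)
      finally show "real (card (\<V> Z)) \<le> 2 ^ l"
        by (metis numeral_power_eq_of_nat_cancel_iff of_nat_le_iff)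
    qed (use q in auto)
    \<comment> \<open>Since \<open>l \<le> 2 * (k + 1)\<close>, the number of subsets is beaten by
      the size of the large fragments; \<open>L \<ge> 4\<close> then leaves a single factor
      \<open>4 / L\<close>.\<close>
    also have "\<dots> \<le> 4 ^ (k + 1) * (1 / L) ^ (k + 1)"
    proof (rule mult_right_mono)
      have "(2::real) ^ l \<le> 2 ^ (2 * (k + 1))" by (rule power_increasing) (auto simp: k_def)
      then show "(2::real) ^ l \<le> 4 ^ (k + 1)" by (simp only: power_mult) simp
    qed (use q in auto)
    also have "\<dots> = (4 / L) ^ (k + 1)" by (simp add: power_divide)
    also have "\<dots> \<le> (4 / L) ^ 1" using q by (intro power_decreasing) auto
    finally show ?thesis using finite_subset[OF S(2)] finS by simp
  qed (use q in auto)
  have "bin_expect q X (\<lambda>W. \<Sum>T\<in>\<U> W. \<theta> ^ card T) =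
      (\<Sum>(W, T)\<in>Sigma (Pow X) \<U>. wt W * \<theta> ^ card T)"
    unfolding bin_expect_def wt_def[symmetric] sum_distrib_left
    using X fin\<U> by (intro sum.Sigma) auto
  \<comment> \<open>Moving \<open>T\<close> into the random set multiplies its weight by
    \<open>(q / (1 - q)) ^ card T\<close>; as \<open>\<theta> = q / L\<close>, at most
    \<open>(1 / L) ^ card T\<close> is left of the cost. The computation is arranged without
    division by \<open>1 - q\<close>.\<close>
  also have "\<dots> \<le> (\<Sum>(W, T)\<in>Sigma (Pow X) \<U>. wt (W \<union> T) * (1 / L) ^ card T)"
  proof (rule sum_mono, clarsimp)
    fix W T assume W: "W \<subseteq> X" "T \<in> \<U> W"
    have fin: "finite W" "finite T" "T \<inter> W = {}" "T \<subseteq> X"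
      using W \<U>D[OF W(2)] finite_subset[OF _ X(1)] by simp_all
    have "card (X - W) = card (X - (W \<union> T)) + card T"
    proof -
      have "X - W = (X - (W \<union> T)) \<union> T" using fin by auto
      also have "card \<dots> = card (X - (W \<union> T)) + card T"
        using fin X(1) by (intro card_Un_disjoint) auto
      finally show ?thesis .
    qed
    then have "wt W * \<theta> ^ card T =
        q ^ card W * (1 - q) ^ card (X - (W \<union> T)) * \<theta> ^ card T * (1 - q) ^ card T"
      by (simp add: wt_def power_add)
    also have "\<dots> \<le> q ^ card W * (1 - q) ^ card (X - (W \<union> T)) * \<theta> ^ card T * 1"
      using q q0 by (intro mult_left_mono power_le_one) auto
    also have "\<dots> = q ^ card W * (1 - q) ^ card (X - (W \<union> T)) * (q ^ card T * (1 / L) ^ card T)"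
      using q by (simp flip: power_mult_distrib)
    also have "\<dots> = wt (W \<union> T) * (1 / L) ^ card T"
      using fin by (simp add: wt_def card_Un_disjoint Int_commute power_add)
    finally show "wt W * \<theta> ^ card T \<le> wt (W \<union> T) * (1 / L) ^ card T" .
  qed
  also have "\<dots> = (\<Sum>(Z, T)\<in>(\<lambda>(W, T). (W \<union> T, T)) ` Sigma (Pow X) \<U>. wt Z * (1 / L) ^ card T)"
  proof (subst sum.reindex)
    show "inj_on (\<lambda>(W, T). (W \<union> T, T)) (Sigma (Pow X) \<U>)"
    proof (rule inj_onI)
      fix a b assume ab: "a \<in> Sigma (Pow X) \<U>" "b \<in> Sigma (Pow X) \<U>"
        "(\<lambda>(W, T). (W \<union> T, T)) a = (\<lambda>(W, T). (W \<union> T, T)) b"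
      have "fst x = (fst x \<union> snd x) - snd x" if "x \<in> Sigma (Pow X) \<U>" for x
        using that \<U>D[of "snd x" "fst x"] by auto
      from this[OF ab(1)] this[OF ab(2)] show "a = b"
        using ab(3) by (auto simp: case_prod_unfold prod_eq_iff)
    qed
  qed (simp add: case_prod_unfold)
  \<comment> \<open>From here on \<open>T\<close> is any candidate that \<open>Z\<close> allows;
    that it came from a fragment is forgotten.\<close>
  also have "\<dots> \<le> (\<Sum>(Z, T)\<in>Sigma (Pow X) \<V>. wt Z * (1 / L) ^ card T)"
  proof (rule sum_mono2)
    show "finite (Sigma (Pow X) \<V>)" using X(1) \<V>_cost by (intro finite_SigmaI) auto
    show "(\<lambda>(W, T). (W \<union> T, T)) ` Sigma (Pow X) \<U> \<subseteq> Sigma (Pow X) \<V>"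
    proof (rule image_subsetI)
      fix x assume "x \<in> Sigma (Pow X) \<U>"
      then show "(\<lambda>(W, T). (W \<union> T, T)) x \<in> Sigma (Pow X) \<V>"
        using \<U>D[of "snd x" "fst x"] by (auto simp: case_prod_unfold)
    qed
    show "0 \<le> (case x of (Z, T) \<Rightarrow> wt Z * (1 / L) ^ card T)" for x
      using wt_nonneg q by (simp add: case_prod_unfold)
  qed
  also have "\<dots> = bin_expect q X (\<lambda>Z. \<Sum>T\<in>\<V> Z. (1 / L) ^ card T)"
    unfolding bin_expect_def wt_def[symmetric] sum_distrib_left
    using X \<V>_cost by (intro sum.Sigma[symmetric]) auto
  also have "\<dots> \<le> bin_expect q X (\<lambda>_. 4 / L)"
    using \<V>_cost q q0 by (intro bin_expect_mono) auto
  finally show ?thesis using X by (simp add: bin_expect_const \<U>_def k_def)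
qed

text \<open>Induction on the rounds with the cost bound \<open>a\<close> left free. If the large
  fragments of a round cost \<open>u\<close>, then a cover of the small ones together with the large
  ones covers \<open>\<H>\<close>, so covering the small ones costs at least \<open>a - u\<close>. A
  failure probability is at most 1, hence the loss is at most \<open>u\<close>, which is
  \<open>4 / L\<close> on average. This linear form makes it unnecessary to condition on a
  successful round.\<close>

lemma miss_prob_cover_cost:
  fixes X :: "'x set" and q L \<theta> :: real
  assumes X: "finite X"
    and q: "q = L * \<theta>" "q \<le> 1" "\<theta> > 0" "L \<ge> 4"
  assumes "\<H> \<subseteq> Pow X" "\<And>S. S \<in> \<H> \<Longrightarrow> card S < 2 ^ m"
    and "\<And>\<U>. \<U> \<subseteq> Pow X \<Longrightarrow> (\<And>S. S \<in> \<H> \<Longrightarrow> \<exists>T\<in>\<U>. T \<subseteq> S) \<Longrightarrow> a \<le> (\<Sum>T\<in>\<U>. \<theta> ^ card T)"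
  shows "miss_prob q X m \<H> * a \<le> 4 * real m / L"
  using assms(6-)
proof (induction m arbitrary: \<H> a)
  case 0
  show ?case
  proof (cases "{} \<in> \<H>")
    case False
    \<comment> \<open>No rounds are left and all members have fewer than \<open>2 ^ 0\<close>
      elements, so none exists; the empty cover then gives \<open>a \<le> 0\<close>.\<close>
    have "\<H> = {}"
    proof (rule ccontr)
      assume "\<H> \<noteq> {}"
      then obtain S where S: "S \<in> \<H>" by auto
      have "finite S" using 0(1) S finite_subset[OF _ X] by blast
      moreover have "card S = 0" using 0(2)[OF S] by simp
      ultimately show False using S False by simp
    qed
    then have "a \<le> 0" using 0(3)[of "{}"] by simp
    with False show ?thesis by simp
  qed simp
next
  case (Suc m)
  have q0: "q \<ge> 0" using q by simp
  \<comment> \<open>With this value \<open>l div 2\<close> is \<open>2 ^ m - 1\<close>, so that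
    small fragments meet the strict bound of the induction hypothesis.\<close>
  define l where "l = 2 ^ Suc m - (1::nat)"
  define \<U> where "\<U> W = {T\<in>min_fragments \<H> W. card T > l div 2}" for W
  define \<H>' where "\<H>' W = {T\<in>min_fragments \<H> W. card T \<le> l div 2}" for W
  have l2: "l div 2 = 2 ^ m - 1"
  proof -
    have "l = 1 + 2 * (2 ^ m - 1)" using one_le_power[of "2::nat" m] unfolding l_def power_Suc by linarith
    then show ?thesis by simp
  qed
  have l2': "l div 2 < 2 ^ m" using l2 by simp
  have min_sub: "min_fragments \<H> W \<subseteq> Pow X" for W
    using Suc.prems(1) by (auto simp: min_fragments_def)
  have fin_min: "finite (min_fragments \<H> W)" for W
    using min_sub X by (meson finite_Pow_iff finite_subset)
  have step: "miss_prob q X m ((\<lambda>S. S - W) ` \<H>) * a \<le>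
      4 * real m / L + (\<Sum>T\<in>\<U> W. \<theta> ^ card T)" for W
  proof (cases "a \<ge> 0")
    case True
    let ?u = "\<Sum>T\<in>\<U> W. \<theta> ^ card T"
    let ?f = "miss_prob q X m (\<H>' W)"
    have u0: "?u \<ge> 0" using q by (intro sum_nonneg) auto
    have "?f * (a - ?u) \<le> 4 * real m / L"
    proof (rule Suc.IH)
      show "\<H>' W \<subseteq> Pow X" using min_sub by (auto simp: \<H>'_def)
      show "card S < 2 ^ m" if "S \<in> \<H>' W" for S
        using that l2' by (auto simp: \<H>'_def)
      fix \<W> assume \<W>: "\<W> \<subseteq> Pow X" "\<And>S. S \<in> \<H>' W \<Longrightarrow> \<exists>T\<in>\<W>. T \<subseteq> S"
      \<comment> \<open>A cover of the small fragments is completed by the large fragments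
        themselves.\<close>
      have "a \<le> (\<Sum>T\<in>\<W> \<union> \<U> W. \<theta> ^ card T)"
      proof (rule Suc.prems(3))
        show "\<W> \<union> \<U> W \<subseteq> Pow X" using \<W>(1) min_sub[of W] by (auto simp only: \<U>_def)
        fix S assume S: "S \<in> \<H>"
        have "S \<subseteq> X" using S Suc.prems(1) by blast
        then have "finite S" using X by (rule finite_subset)
        from min_fragments_cover[OF this S, of W]
        obtain T where T: "T \<in> min_fragments \<H> W" "T \<subseteq> S" by auto
        then have "T \<in> \<U> W \<or> T \<in> \<H>' W" by (auto simp: \<U>_def \<H>'_def)
        then show "\<exists>T\<in>\<W> \<union> \<U> W. T \<subseteq> S"
        proof
          assume "T \<in> \<H>' W"
          from \<W>(2)[OF this] obtain T' where "T' \<in> \<W>" "T' \<subseteq> T" by auto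
          then show ?thesis using T(2) by (intro bexI[of _ T']) auto
        qed (use T(2) in auto)
      qed
      also have "\<dots> \<le> (\<Sum>T\<in>\<W>. \<theta> ^ card T) + ?u"
      proof -
        have "finite \<W>" "finite (\<U> W)"
          using finite_subset[OF \<W>(1)] X fin_min[of W] by (simp_all add: \<U>_def)
        then have "(\<Sum>T\<in>\<W> \<union> \<U> W. \<theta> ^ card T) + (\<Sum>T\<in>\<W> \<inter> \<U> W. \<theta> ^ card T) =
            (\<Sum>T\<in>\<W>. \<theta> ^ card T) + ?u"
          by (rule sum.union_inter)
        moreover have "(\<Sum>T\<in>\<W> \<inter> \<U> W. \<theta> ^ card T) \<ge> 0" using q by (intro sum_nonneg) auto
        ultimately show ?thesis by linarith
      qed
      finally show "a - ?u \<le> (\<Sum>T\<in>\<W>. \<theta> ^ card T)" by simp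
    qed
    moreover have "?f * ?u \<le> 1 * ?u"
      using miss_prob_bounds[OF X q0 q(2)] u0 by (intro mult_right_mono) auto
    moreover have "miss_prob q X m ((\<lambda>S. S - W) ` \<H>) * a \<le> ?f * a"
      using True q0 q(2) by (intro mult_right_mono miss_prob_antimono)
        (auto simp: \<H>'_def min_fragments_def)
    ultimately show ?thesis by (simp add: algebra_simps)
  next
    case False
    have "miss_prob q X m ((\<lambda>S. S - W) ` \<H>) * a \<le> 0"
      using miss_prob_bounds[OF X q0 q(2)] False by (simp add: mult_nonneg_nonpos)
    moreover have "0 \<le> 4 * real m / L + (\<Sum>T\<in>\<U> W. \<theta> ^ card T)"
      using q by (intro add_nonneg_nonneg sum_nonneg) auto
    ultimately show ?thesis by linarith
  qed
  have "miss_prob q X (Suc m) \<H> * a = bin_expect q X (\<lambda>W. a * miss_prob q X m ((\<lambda>S. S - W) ` \<H>))"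
    by (simp add: bin_expect_cmult)
  also have "\<dots> \<le> bin_expect q X (\<lambda>W. 4 * real m / L + (\<Sum>T\<in>\<U> W. \<theta> ^ card T))"
    using step q0 q(2) by (intro bin_expect_mono) (auto simp: mult.commute)
  also have "\<dots> = 4 * real m / L + bin_expect q X (\<lambda>W. \<Sum>T\<in>\<U> W. \<theta> ^ card T)"
    using X by (simp add: bin_expect_add bin_expect_const)
  also have "bin_expect q X (\<lambda>W. \<Sum>T\<in>\<U> W. \<theta> ^ card T) \<le> 4 / L"
    unfolding \<U>_def
  proof (rule large_fragments_cost[OF X Suc.prems(1) _ q])
    show "card S \<le> l" if "S \<in> \<H>" for S
      using Suc.prems(2)[OF that] by (simp add: l_def)
  qed
  finally show ?case by (simp add: add_divide_distrib algebra_simps)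
qed

text \<open>Union bound: each \<open>T\<close> of a cover accounts for at most a fraction
  \<open>\<theta> ^ card T\<close> of the indices, so every cover costs at least 1. The family is
  indexed because different pairs of permutations can give the same copy.\<close>

lemma spread_miss_prob:
  fixes f :: "'i \<Rightarrow> 'x set" and q L \<theta> :: real
  assumes X: "finite X"
    and q: "q = L * \<theta>" "q \<le> 1" "\<theta> > 0" "L \<ge> 4"
    and I: "finite I" "I \<noteq> {}"
    and f: "\<And>i. i \<in> I \<Longrightarrow> f i \<subseteq> X \<and> card (f i) < 2 ^ m"
    and spread: "\<And>T. T \<subseteq> X \<Longrightarrow> real (card {i\<in>I. T \<subseteq> f i}) \<le> \<theta> ^ card T * card I"
  shows "miss_prob q X m (f ` I) \<le> 4 * real m / L"
proof -
  have "miss_prob q X m (f ` I) * 1 \<le> 4 * real m / L"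
  proof (rule miss_prob_cover_cost[OF X q(1) q(2) q(3) q(4)])
    show "f ` I \<subseteq> Pow X" using f by (simp add: image_subset_iff)
    show "card S < 2 ^ m" if "S \<in> f ` I" for S
      using that f by (elim imageE) simp
    fix \<U> assume \<U>: "\<U> \<subseteq> Pow X" "\<And>S. S \<in> f ` I \<Longrightarrow> \<exists>T\<in>\<U>. T \<subseteq> S"
    have fin: "finite \<U>" using \<U>(1) X by (meson finite_Pow_iff finite_subset)
    have "\<exists>T\<in>\<U>. T \<subseteq> f i" if "i \<in> I" for i using \<U>(2)[of "f i"] that by simp
    then have "I = (\<Union>T\<in>\<U>. {i\<in>I. T \<subseteq> f i})" by blast
    then have "real (card I) \<le> real (\<Sum>T\<in>\<U>. card {i\<in>I. T \<subseteq> f i})"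
      using card_UN_le[OF fin, of "\<lambda>T. {i\<in>I. T \<subseteq> f i}"] by (metis of_nat_mono)
    also have "\<dots> \<le> (\<Sum>T\<in>\<U>. \<theta> ^ card T * card I)"
      unfolding of_nat_sum using \<U>(1) by (intro sum_mono spread) auto
    finally have "real (card I) \<le> (\<Sum>T\<in>\<U>. \<theta> ^ card T) * card I"
      by (simp add: sum_distrib_right)
    moreover have "real (card I) > 0" using I by (simp add: card_gt_0_iff)
    ultimately show "1 \<le> (\<Sum>T\<in>\<U>. \<theta> ^ card T)" by simp
  qed
  then show ?thesis by simp
qed

section \<open>Random colourings\<close>

lemma bin_expect_swap:
  "bin_expect q X (\<lambda>W. bin_expect q' Y (g W)) = bin_expect q' Y (\<lambda>W'. bin_expect q X (\<lambda>W. g W W'))"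
  unfolding bin_expect_def sum_distrib_left
  by (subst sum.swap) (simp add: mult_ac)

lemma bin_expect_mem:
  assumes "finite X" "x \<in> X"
  shows "bin_expect q X (\<lambda>W. of_bool (x \<in> W)) = q"
proof -
  have "bin_expect q (insert x (X - {x})) (\<lambda>W. of_bool (x \<in> W)) =
      (1 - q) * bin_expect q (X - {x}) (\<lambda>W. of_bool (x \<in> W))
      + q * bin_expect q (X - {x}) (\<lambda>W. of_bool (x \<in> insert x W))"
    using assms by (intro bin_expect_insert) auto
  also have "bin_expect q (X - {x}) (\<lambda>W. of_bool (x \<in> W)) = bin_expect q (X - {x}) (\<lambda>_. 0)"
    by (rule bin_expect_cong) auto
  finally show ?thesis using assms by (simp add: bin_expect_const insert_absorb)
qed

text \<open>The coloured edges of the random coloured graph, but over any ground set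
  \<open>A\<close>, so that induction can add one element at a time.\<close>

definition colored_subset :: "nat \<Rightarrow> real \<Rightarrow> 'e set \<Rightarrow> ('e \<times> nat) set pmf" where
  "colored_subset c p A =
    bind_pmf (Pi_pmf A False (\<lambda>_. bernoulli_pmf p)) (\<lambda>X.
      map_pmf (\<lambda>col. {(e, col e) | e. e \<in> A \<and> X e})
        (Pi_pmf {e \<in> A. X e} 0 (\<lambda>_. pmf_of_set {1..c})))"

lemma colored_subset_empty: "colored_subset c p {} = return_pmf {}"
  by (simp add: colored_subset_def bind_return_pmf)

text \<open>The definition draws all coins before all colours; commuting independent draws moves the
  coin and the colour of \<open>e\<close> to the end.\<close>

lemma colored_subset_insert:
  assumes "finite A" "e \<notin> A"
  shows "colored_subset c p (insert e A) =
    bind_pmf (colored_subset c p A) (\<lambda>U. bind_pmf (bernoulli_pmf p) (\<lambda>b.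
      if b then map_pmf (\<lambda>j. insert (e, j) U) (pmf_of_set {1..c}) else return_pmf U))"
proof -
  let ?u = "pmf_of_set {1..c}"
  let ?M = "\<lambda>f. Pi_pmf {a \<in> A. f a} 0 (\<lambda>_. ?u)"
  have eq: "map_pmf (\<lambda>col. {(a, col a) | a. a \<in> insert e A \<and> (f(e := b)) a})
        (Pi_pmf {a \<in> insert e A. (f(e := b)) a} 0 (\<lambda>_. ?u)) =
      bind_pmf (map_pmf (\<lambda>col. {(a, col a) | a. a \<in> A \<and> f a}) (?M f)) (\<lambda>U.
        if b then map_pmf (\<lambda>j. insert (e, j) U) ?u else return_pmf U)" for b f
  proof (cases b)
    case True
    have "{a \<in> insert e A. (f(e := b)) a} = insert e {a \<in> A. f a}"
      using True assms by auto
    then have "Pi_pmf {a \<in> insert e A. (f(e := b)) a} 0 (\<lambda>_. ?u) =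
        bind_pmf ?u (\<lambda>j. bind_pmf (?M f) (\<lambda>col. return_pmf (col(e := j))))"
      using assms by (simp add: Pi_pmf_insert')
    moreover have "{(a, (col(e := j)) a) | a. a \<in> insert e A \<and> (f(e := b)) a} =
        insert (e, j) {(a, col a) | a. a \<in> A \<and> f a}" for j :: nat and col
      using True assms by auto
    ultimately have "map_pmf (\<lambda>col. {(a, col a) | a. a \<in> insert e A \<and> (f(e := b)) a})
        (Pi_pmf {a \<in> insert e A. (f(e := b)) a} 0 (\<lambda>_. ?u)) =
        bind_pmf ?u (\<lambda>j. bind_pmf (?M f) (\<lambda>col.
          return_pmf (insert (e, j) {(a, col a) | a. a \<in> A \<and> f a})))"
      by (simp add: map_bind_pmf map_pmf_comp)
    also have "\<dots> = bind_pmf (?M f) (\<lambda>col. bind_pmf ?u (\<lambda>j.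
          return_pmf (insert (e, j) {(a, col a) | a. a \<in> A \<and> f a})))"
      by (rule bind_commute_pmf)
    finally show ?thesis using True
      by (simp add: bind_map_pmf map_pmf_def bind_assoc_pmf bind_return_pmf)
  next
    case False
    have "{a \<in> insert e A. (f(e := b)) a} = {a \<in> A. f a}"
      "{(a, col a) | a. a \<in> insert e A \<and> (f(e := b)) a} =
         {(a, col a) | a. a \<in> A \<and> f a}" for col :: "'a \<Rightarrow> nat"
      using False assms by auto
    then show ?thesis using False by (simp add: bind_map_pmf map_pmf_def bind_assoc_pmf bind_return_pmf)
  qed
  have "colored_subset c p (insert e A) =
     bind_pmf (bernoulli_pmf p) (\<lambda>b. bind_pmf (Pi_pmf A False (\<lambda>_. bernoulli_pmf p)) (\<lambda>f.
       bind_pmf (map_pmf (\<lambda>col. {(a, col a) | a. a \<in> A \<and> f a}) (?M f)) (\<lambda>U.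
        if b then map_pmf (\<lambda>j. insert (e, j) U) ?u else return_pmf U)))"
    unfolding colored_subset_def Pi_pmf_insert'[OF assms] bind_assoc_pmf bind_return_pmf eq
    by (rule refl)
  also have "\<dots> = bind_pmf (bernoulli_pmf p) (\<lambda>b. bind_pmf (colored_subset c p A) (\<lambda>U.
        if b then map_pmf (\<lambda>j. insert (e, j) U) ?u else return_pmf U))"
    unfolding colored_subset_def bind_assoc_pmf by (rule refl)
  also have "\<dots> = bind_pmf (colored_subset c p A) (\<lambda>U. bind_pmf (bernoulli_pmf p) (\<lambda>b.
        if b then map_pmf (\<lambda>j. insert (e, j) U) ?u else return_pmf U))"
    by (rule bind_commute_pmf)
  finally show ?thesis .
qed

lemma finite_colored_subset:
  assumes "finite A" "c > 0"
  shows "finite (set_pmf (colored_subset c p A))"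
  using assms(1)
proof (induction A rule: finite_induct)
  case (insert e A)
  have "finite (set_pmf (pmf_of_set {1..c}))" using assms(2) by (subst set_pmf_of_set) auto
  moreover have "finite (set_pmf (bernoulli_pmf p))" by (rule finite_subset[of _ UNIV]) auto
  ultimately show ?case using insert by (auto simp: colored_subset_insert)
qed (simp add: colored_subset_empty)

lemma colored_subset_insert_expectation:
  assumes "finite A" "e \<notin> A" "c > 0" "0 \<le> p" "p \<le> 1"
  shows "measure_pmf.expectation (colored_subset c p (insert e A)) g =
    measure_pmf.expectation (colored_subset c p A) (\<lambda>U. (1 - p) * g U + p * (\<Sum>j=1..c. g (insert (e, j) U)) / c)"
proof -
  let ?u = "pmf_of_set {1..c}"
  let ?K = "\<lambda>U. bind_pmf (bernoulli_pmf p) (\<lambda>b.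
        if b then map_pmf (\<lambda>j. insert (e, j) U) ?u else return_pmf U)"
  have fu: "finite (set_pmf ?u)" using assms by (subst set_pmf_of_set) auto
  have u: "measure_pmf.expectation ?u h = (\<Sum>j=1..c. h j) / c" for h :: "nat \<Rightarrow> real"
    using assms by (subst integral_pmf_of_set) auto
  have K: "measure_pmf.expectation (?K U) g = (1 - p) * g U + p * (\<Sum>j=1..c. g (insert (e, j) U)) / c" for U
  proof -
    have "measure_pmf.expectation (?K U) g = (\<Sum>b\<in>UNIV. pmf (bernoulli_pmf p) b *\<^sub>R
       measure_pmf.expectation (if b then map_pmf (\<lambda>j. insert (e, j) U) ?u else return_pmf U) g)"
      using fu by (intro pmf_expectation_bind) auto
    then show ?thesis using assms by (simp add: UNIV_bool u del: One_nat_def)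
  qed
  have fin: "finite (set_pmf (colored_subset c p A))" by (rule finite_colored_subset) fact+
  have "measure_pmf.expectation (colored_subset c p (insert e A)) g =
     (\<Sum>U\<in>set_pmf (colored_subset c p A). pmf (colored_subset c p A) U *\<^sub>R measure_pmf.expectation (?K U) g)"
    unfolding colored_subset_insert[OF assms(1,2)]
    using fin fu finite_subset[of "set_pmf (bernoulli_pmf p)" UNIV]
    by (intro pmf_expectation_bind) auto
  also have "\<dots> = measure_pmf.expectation (colored_subset c p A)
      (\<lambda>U. (1 - p) * g U + p * (\<Sum>j=1..c. g (insert (e, j) U)) / c)"
    unfolding K by (subst integral_measure_pmf[OF fin]) auto
  finally show ?thesis .
qed

text \<open>A hybrid argument in the spirit of McDiarmid: the exclusive choice of at most one colour
  per element is exchanged for independent choices, one element at a time.\<close>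

lemma colored_subset_le_bin_expect:
  assumes "finite A" "c > 0" "0 \<le> p" "p \<le> 1" "0 \<le> q" "q \<le> 1"
    and "\<And>e U. e \<in> A \<Longrightarrow> (1 - p) * g U + p * (\<Sum>j=1..c. g (insert (e, j) U)) / c
      \<le> bin_expect q ({e} \<times> {1..c}) (\<lambda>B. g (U \<union> B))"
  shows "measure_pmf.expectation (colored_subset c p A) g \<le> bin_expect q (A \<times> {1..c}) g"
  using assms(1,7)
proof (induction A arbitrary: g rule: finite_induct)
  case empty
  then show ?case by (simp add: colored_subset_empty)
next
  case (insert e A)
  define h where "h U = bin_expect q ({e} \<times> {1..c}) (\<lambda>B. g (U \<union> B))" for U
  have fin: "finite (set_pmf (colored_subset c p A))" by (rule finite_colored_subset) fact+
  have "measure_pmf.expectation (colored_subset c p (insert e A)) g =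
    measure_pmf.expectation (colored_subset c p A) (\<lambda>U. (1 - p) * g U + p * (\<Sum>j=1..c. g (insert (e, j) U)) / c)"
    using insert.hyps assms by (intro colored_subset_insert_expectation) auto
  also have "\<dots> \<le> measure_pmf.expectation (colored_subset c p A) h"
    unfolding h_def using insert.prems fin
    by (intro integral_mono integrable_measure_pmf_finite) auto
  \<comment> \<open>Averaging over the independent colours of \<open>e\<close> preserves the
    one-step inequality at \<open>e'\<close>, because that inequality is assumed for every
    \<open>U\<close>.\<close>
  also have "\<dots> \<le> bin_expect q (A \<times> {1..c}) h"
  proof (rule insert.IH)
    fix e' U assume "e' \<in> A"
    have "(1 - p) * h U + p * (\<Sum>j=1..c. h (insert (e', j) U)) / c =
      bin_expect q ({e} \<times> {1..c}) (\<lambda>B. (1 - p) * g (U \<union> B) + (p / c) * (\<Sum>j=1..c. g (insert (e', j) (U \<union> B))))"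
      unfolding h_def bin_expect_add bin_expect_cmult bin_expect_sum by simp
    also have "\<dots> \<le> bin_expect q ({e} \<times> {1..c}) (\<lambda>B. bin_expect q ({e'} \<times> {1..c}) (\<lambda>B'. g ((U \<union> B) \<union> B')))"
      using insert.prems[of e'] \<open>e' \<in> A\<close> assms by (intro bin_expect_mono) auto
    also have "\<dots> = bin_expect q ({e'} \<times> {1..c}) (\<lambda>B'. h (U \<union> B'))"
      unfolding h_def by (subst bin_expect_swap) (simp add: Un_ac)
    finally show "(1 - p) * h U + p * (\<Sum>j=1..c. h (insert (e', j) U)) / c \<le>
      bin_expect q ({e'} \<times> {1..c}) (\<lambda>B'. h (U \<union> B'))" .
  qed
  also have "\<dots> = bin_expect q (A \<times> {1..c} \<union> {e} \<times> {1..c}) g"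
    unfolding h_def using insert.hyps by (intro bin_expect_union[symmetric]) auto
  also have "A \<times> {1..c} \<union> {e} \<times> {1..c} = insert e A \<times> {1..c}" by auto
  finally show ?case .
qed

text \<open>A set in which no element carries two colours can be completed by one element in only
  one way, so the union bound for independent colours beats the exclusive choice.\<close>

lemma colored_subset_miss_le:
  fixes \<H> :: "('e \<times> nat) set set"
  assumes "finite A" "c > 0" "p \<le> 1" "0 \<le> q" "q \<le> p / c"
    and single: "\<And>S e i j. S \<in> \<H> \<Longrightarrow> (e, i) \<in> S \<Longrightarrow> (e, j) \<in> S \<Longrightarrow> i = j"
    and sub: "\<And>S. S \<in> \<H> \<Longrightarrow> S \<subseteq> A \<times> {1..c}"
  shows "measure_pmf.expectation (colored_subset c p A) (\<lambda>U. if \<exists>S\<in>\<H>. S \<subseteq> U then 0 else 1) \<le>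
    bin_expect q (A \<times> {1..c}) (\<lambda>U. if \<exists>S\<in>\<H>. S \<subseteq> U then 0 else 1)"
proof (rule colored_subset_le_bin_expect)
  have "0 \<le> p / c" using assms by linarith
  then show p0: "0 \<le> p" using \<open>c > 0\<close> by (simp add: zero_le_divide_iff)
  have "p / c \<le> p / 1" using \<open>c > 0\<close> p0 by (intro divide_left_mono) auto
  then show q1: "q \<le> 1" using assms by simp
  define g :: "('e \<times> nat) set \<Rightarrow> real" where "g U = (if \<exists>S\<in>\<H>. S \<subseteq> U then 0 else 1)" for U
  fix e U assume "e \<in> A"
  let ?Y = "{e} \<times> {1..c}"
  have "(1 - p) * g U + p * (\<Sum>j=1..c. g (insert (e, j) U)) / c \<le> bin_expect q ?Y (\<lambda>B. g (U \<union> B))"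
  proof (cases "\<exists>S\<in>\<H>. S \<subseteq> U")
    case True
    then have z: "g (U \<union> B) = 0" "g (insert x U) = 0" "g U = 0" for B x unfolding g_def by auto
    show ?thesis unfolding z by (simp add: bin_expect_const)
  next
    case False
    \<comment> \<open>The colours of \<open>e\<close> that complete a member. The exclusive choice
      misses with probability exactly \<open>1 - (p / c) * card J\<close>; for independent choices
      \<open>1 - q * card J\<close> is a lower bound.\<close>
    define J where "J = {j\<in>{1..c}. \<exists>S\<in>\<H>. S \<subseteq> insert (e, j) U}"
    have J: "finite J" "J \<subseteq> {1..c}" by (auto simp: J_def)
    have "(\<Sum>j=1..c. g (insert (e, j) U)) = (\<Sum>j=1..c. 1 - of_bool (j \<in> J))"
      by (rule sum.cong) (auto simp: g_def J_def)
    also have "\<dots> = real c - real (card J)"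
      using J by (simp add: sum_subtractf of_bool_def sum.If_cases Int_absorb1)
    finally have sumJ: "(\<Sum>j=1..c. g (insert (e, j) U)) = real c - real (card J)" .
    have "g U = 1" using False by (simp add: g_def)
    then have "(1 - p) * g U + p * (\<Sum>j=1..c. g (insert (e, j) U)) / c = 1 - (p / c) * card J"
      unfolding sumJ using \<open>c > 0\<close> by (simp add: field_simps)
    also have "\<dots> \<le> 1 - q * card J"
      using assms(5) by (intro diff_left_mono mult_right_mono) auto
    also have "\<dots> = bin_expect q ?Y (\<lambda>B. 1 + (-1) * (\<Sum>j\<in>J. of_bool ((e, j) \<in> B)))"
    proof -
      have "bin_expect q ?Y (\<lambda>B. of_bool ((e, j) \<in> B)) = q" if "j \<in> J" for j
        using J that by (intro bin_expect_mem) auto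
      then show ?thesis unfolding bin_expect_add bin_expect_cmult bin_expect_sum
        by (simp add: bin_expect_const)
    qed
    also have "\<dots> \<le> bin_expect q ?Y (\<lambda>B. g (U \<union> B))"
    proof (rule bin_expect_mono)
      fix B assume B: "B \<subseteq> ?Y"
      show "1 + (-1) * (\<Sum>j\<in>J. of_bool ((e, j) \<in> B)) \<le> g (U \<union> B)"
      proof (cases "\<exists>S\<in>\<H>. S \<subseteq> U \<union> B")
        case True
        then obtain S where S: "S \<in> \<H>" "S \<subseteq> U \<union> B" by auto
        have "\<not> S \<subseteq> U" using False S by auto
        then obtain j where j: "(e, j) \<in> S" "(e, j) \<in> B" using S B by auto
        \<comment> \<open>Whatever \<open>S\<close> has outside \<open>U\<close> lies over
          \<open>e\<close>, and \<open>single\<close> allows only the colour \<open>j\<close>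
          there.\<close>
        have "S \<subseteq> insert (e, j) U"
        proof
          fix x assume x: "x \<in> S"
          show "x \<in> insert (e, j) U"
          proof (cases "x \<in> U")
            case False
            then have "x \<in> B" using x S by auto
            then obtain i where "x = (e, i)" using B by auto
            then show ?thesis using single[OF S(1)] x j by auto
          qed auto
        qed
        then have jJ: "j \<in> J" using S(1) j B by (auto simp: J_def)
        have "(\<Sum>i\<in>{j}. of_bool ((e, i) \<in> B)) \<le> (\<Sum>i\<in>J. of_bool ((e, i) \<in> B) :: real)"
          using J jJ by (intro sum_mono2) auto
        then show ?thesis using j(2) True by (simp add: g_def)
      next
        case False
        have "(\<Sum>j\<in>J. of_bool ((e, j) \<in> B)) \<ge> (0::real)" by (intro sum_nonneg) auto
        then show ?thesis using False by (simp add: g_def)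
      qed
    qed (use assms q1 in auto)
    finally show ?thesis .
  qed
  then show "(1 - p) * (if \<exists>S\<in>\<H>. S \<subseteq> U then 0 else 1)
      + p * (\<Sum>j=1..c. (if \<exists>S\<in>\<H>. S \<subseteq> insert (e, j) U then 0 else 1)) / c
      \<le> bin_expect q ?Y (\<lambda>B. if \<exists>S\<in>\<H>. S \<subseteq> U \<union> B then 0 else 1)"
    unfolding g_def .
qed (use assms in auto)

section \<open>Random embeddings\<close>

text \<open>The random copy is the preimage of \<open>E\<close> under \<open>\<pi>\<close>; it
  contains \<open>F\<close> exactly when \<open>\<pi>\<close> maps \<open>F\<close> into
  \<open>E\<close>.\<close>

definition embeddings :: "'v set set \<Rightarrow> 'v set \<Rightarrow> 'v set set \<Rightarrow> ('v \<Rightarrow> 'v) set" where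
  "embeddings E V F = {\<pi>. \<pi> permutes V \<and> (\<forall>e\<in>F. \<pi> ` e \<in> E)}"

lemma finite_embeddings: "finite V \<Longrightarrow> finite (embeddings E V F)"
  unfolding embeddings_def by (rule finite_subset[OF _ finite_permutations]) auto

text \<open>By symmetry the number of embeddings extending along \<open>{x, z}\<close> does not depend on the
  new vertex \<open>z\<close>, and the sum over all \<open>z\<close> is controlled by the degrees in \<open>E\<close>.\<close>

lemma card_embeddings_insert:
  assumes "finite V" "F \<subseteq> Pow V" "x \<in> V" "y \<in> V" "y \<notin> \<Union>F" "x \<noteq> y"
    and deg: "\<And>v. v \<in> V \<Longrightarrow> card {z\<in>V. {v, z} \<in> E} \<le> \<Delta>"
  shows "card (embeddings E V (insert {x, y} F)) * (card V - card (insert x (\<Union>F))) \<le>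
    \<Delta> * card (embeddings E V F)"
proof -
  define Y where "Y = V - insert x (\<Union>F)"
  define A where "A z = {\<pi>\<in>embeddings E V F. {\<pi> x, \<pi> z} \<in> E}" for z
  have finY: "finite Y" using assms by (simp add: Y_def)
  have finA: "finite (A z)" for z using finite_embeddings[OF assms(1)] by (simp add: A_def)
  have cardY: "card Y = card V - card (insert x (\<Union>F))"
    unfolding Y_def using assms by (intro card_Diff_subset) (auto intro: finite_subset)
  have Ay: "embeddings E V (insert {x, y} F) = A y"
    by (auto simp: embeddings_def A_def)
  have "card (A y) \<le> card (A z)" if z: "z \<in> Y" for z
  proof (rule card_inj_on_le)
    \<comment> \<open>Swapping \<open>y\<close> and \<open>z\<close> fixes \<open>x\<close> and
      every edge of \<open>F\<close>, as both vertices lie outside \<open>F\<close>.\<close>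
    show "inj_on (\<lambda>\<pi>. \<pi> \<circ> Transposition.transpose y z) (A y)"
      by (rule inj_onI) (metis comp_assoc transpose_comp_involutory comp_id)
    show "(\<lambda>\<pi>. \<pi> \<circ> Transposition.transpose y z) ` A y \<subseteq> A z"
    proof (rule image_subsetI)
      fix \<pi> assume \<pi>: "\<pi> \<in> A y"
      have tr: "Transposition.transpose y z ` e = e" if "e \<in> F" for e
      proof -
        have "y \<notin> e" "z \<notin> e" using that assms z by (auto simp: Y_def)
        then have "Transposition.transpose y z ` e = id ` e"
          by (intro image_cong) (auto simp: Transposition.transpose_def)
        then show ?thesis by simp
      qed
      have "(\<pi> \<circ> Transposition.transpose y z) ` e \<in> E" if "e \<in> F" for e
      proof -
        have "(\<pi> \<circ> Transposition.transpose y z) ` e = \<pi> ` e"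
          unfolding image_comp[symmetric] using tr[OF that] by (rule arg_cong)
        then show ?thesis using \<pi> that by (simp add: A_def embeddings_def)
      qed
      moreover have "\<pi> \<circ> Transposition.transpose y z permutes V"
        using \<pi> assms z by (intro permutes_compose permutes_swap_id)
          (auto simp: A_def embeddings_def Y_def)
      moreover have "Transposition.transpose y z x = x" "Transposition.transpose y z z = y"
        using assms z by (auto simp: Y_def Transposition.transpose_def)
      ultimately show "\<pi> \<circ> Transposition.transpose y z \<in> A z"
        using \<pi> by (auto simp: A_def embeddings_def)
    qed
  qed (rule finA)
  then have "card (A y) * card Y \<le> (\<Sum>z\<in>Y. card (A z))"
    using sum_mono[of Y "\<lambda>_. card (A y)" "\<lambda>z. card (A z)"] by (simp add: mult.commute)
  also have "\<dots> = (\<Sum>z\<in>Y. \<Sum>\<pi>\<in>embeddings E V F. of_bool ({\<pi> x, \<pi> z} \<in> E))"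
    using finite_embeddings[OF assms(1)]
    by (intro sum.cong) (auto simp: A_def of_bool_def sum.If_cases Int_def)
  also have "\<dots> = (\<Sum>\<pi>\<in>embeddings E V F. \<Sum>z\<in>Y. of_bool ({\<pi> x, \<pi> z} \<in> E))"
    by (rule sum.swap)
  also have "\<dots> \<le> (\<Sum>\<pi>\<in>embeddings E V F. \<Delta>)"
  proof (rule sum_mono)
    fix \<pi> assume "\<pi> \<in> embeddings E V F"
    then have \<pi>: "\<pi> permutes V" by (simp add: embeddings_def)
    have "(\<Sum>z\<in>Y. of_bool ({\<pi> x, \<pi> z} \<in> E)) = card {z\<in>Y. {\<pi> x, \<pi> z} \<in> E}"
      using finY by (simp add: of_bool_def sum.If_cases Int_def)
    also have "\<dots> \<le> card {z\<in>V. {\<pi> x, z} \<in> E}"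
    proof (rule card_inj_on_le)
      show "inj_on \<pi> {z\<in>Y. {\<pi> x, \<pi> z} \<in> E}" using permutes_inj_on[OF \<pi>] .
      show "\<pi> ` {z\<in>Y. {\<pi> x, \<pi> z} \<in> E} \<subseteq> {z\<in>V. {\<pi> x, z} \<in> E}"
        using permutes_in_image[OF \<pi>] by (auto simp: Y_def)
    qed (use assms in auto)
    also have "\<dots> \<le> \<Delta>" using permutes_in_image[OF \<pi>] assms(3) by (intro deg) auto
    finally show "(\<Sum>z\<in>Y. of_bool ({\<pi> x, \<pi> z} \<in> E)) \<le> \<Delta>" .
  qed
  finally show ?thesis by (simp add: Ay cardY mult.commute)
qed

section \<open>Forests and the number of their embeddings\<close>

text \<open>Only \<open>y\<close> has to be new: if \<open>x\<close> occurs already, the edge is a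
  leaf, otherwise it starts a component. Embeddings are counted in this order.\<close>

inductive forest :: "'v set set \<Rightarrow> bool" where
  empty: "forest {}"
| insert: "forest F \<Longrightarrow> y \<notin> \<Union>F \<Longrightarrow> x \<noteq> y \<Longrightarrow> forest (insert {x, y} F)"

text \<open>The lower bound on the number of vertices makes
  \<open>card (\<Union>F) - card F\<close>, the number of components, an honest subtraction; the
  upper bound turns \<open>exp\<close> of the number of vertices into \<open>exp 2\<close> per
  edge.\<close>

lemma forest_finite:
  "forest F \<Longrightarrow> finite F \<and> finite (\<Union>F) \<and> card F \<le> card (\<Union>F) \<and> card (\<Union>F) \<le> 2 * card F"
proof (induction rule: forest.induct)
  case (insert F y x)
  then have "{x, y} \<notin> F" by auto
  moreover have "\<Union>(insert {x, y} F) = insert y (insert x (\<Union>F))" by auto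
  ultimately show ?case using insert by (auto simp: card_insert_if)
qed simp

text \<open>Heuristically: at most \<open>card V\<close> images for one vertex of each component, at
  most \<open>\<Delta>\<close> for each further vertex of the forest, and any arrangement of the
  rest. In the induction the factor on the left of \<open>card_embeddings_insert\<close> cancels
  against the factorial.\<close>

lemma card_forest_embeddings:
  assumes "forest F" "finite V" "F \<subseteq> Pow V"
    and deg: "\<And>v. v \<in> V \<Longrightarrow> card {z\<in>V. {v, z} \<in> E} \<le> \<Delta>"
  shows "card (embeddings E V F) \<le>
    \<Delta> ^ card F * card V ^ (card (\<Union>F) - card F) * fact (card V - card (\<Union>F))"
  using assms(1,3)
proof (induction rule: forest.induct)
  case empty
  then show ?case using assms(2) by (simp add: embeddings_def card_permutations)
next
  case (insert F y x)
  let ?n = "card V" and ?v = "card (\<Union>F)" and ?f = "card F"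
  let ?N = "card (embeddings E V F)" and ?N' = "card (embeddings E V (insert {x, y} F))"
  have xy: "x \<in> V" "y \<in> V" "F \<subseteq> Pow V" using insert.prems by auto
  have IH: "?N \<le> \<Delta> ^ ?f * ?n ^ (?v - ?f) * fact (?n - ?v)" using insert.IH xy by simp
  have step: "?N' * (?n - card (insert x (\<Union>F))) \<le> \<Delta> * ?N"
    using insert.hyps xy by (intro card_embeddings_insert assms) auto
  have fin: "finite (\<Union>F)" "?f \<le> ?v" "finite F" using forest_finite[OF insert.hyps(1)] by auto
  have "{x, y} \<notin> F" using insert.hyps by auto
  then have f': "card (insert {x, y} F) = Suc ?f" using fin by simp
  have U: "\<Union>(insert {x, y} F) = insert y (insert x (\<Union>F))" by auto
  have le: "card (insert y (insert x (\<Union>F))) \<le> ?n" using xy assms(2) by (intro card_mono) auto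
  show ?case
  proof (cases "x \<in> \<Union>F")
    case True
    then have v': "card (\<Union>(insert {x, y} F)) = Suc ?v" unfolding U
      using fin insert.hyps by (simp add: insert_absorb)
    then have "?v < ?n" using le U by simp
    then obtain r where r: "?n - ?v = Suc r" by (metis Suc_diff_Suc)
    then have r': "?n - Suc ?v = r" by simp
    have "?N' * Suc r \<le> \<Delta> * (\<Delta> ^ ?f * ?n ^ (?v - ?f) * fact (?n - ?v))"
      using step IH True r by (metis insert_absorb mult_le_mono2 order_trans)
    also have "\<dots> = (\<Delta> ^ Suc ?f * ?n ^ (?v - ?f) * fact r) * Suc r"
      unfolding r by (simp add: algebra_simps)
    finally have "?N' \<le> \<Delta> ^ Suc ?f * ?n ^ (?v - ?f) * fact r"
      using mult_le_cancel2 by blast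
    then show ?thesis using v' f' r' by simp
  next
    case False
    then have c: "card (insert x (\<Union>F)) = Suc ?v" using fin by simp
    then have v': "card (\<Union>(insert {x, y} F)) = Suc (Suc ?v)" unfolding U
      using fin insert.hyps by (simp add: card_insert_if)
    then have "Suc ?v < ?n" using le U by simp
    then obtain r where r: "?n - Suc ?v = Suc r" by (metis Suc_diff_Suc)
    then have r': "?n - Suc (Suc ?v) = r" "?n - ?v = Suc (Suc r)" by simp_all
    have "?N' * Suc r \<le> \<Delta> * (\<Delta> ^ ?f * ?n ^ (?v - ?f) * fact (?n - ?v))"
      using step IH c r by (metis mult_le_mono2 order_trans)
    also have "\<dots> = (\<Delta> ^ Suc ?f * ?n ^ (?v - ?f) * (?n - ?v) * fact r) * Suc r"
      unfolding r' by (simp add: algebra_simps)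
    finally have "?N' \<le> \<Delta> ^ Suc ?f * ?n ^ (?v - ?f) * (?n - ?v) * fact r"
      using mult_le_cancel2 by blast
    \<comment> \<open>Two vertices are new, but only one factor of the factorial was cancelled; the
      other is bounded by \<open>card V\<close> and pays for the new component.\<close>
    also have "\<dots> \<le> \<Delta> ^ Suc ?f * ?n ^ (?v - ?f) * ?n * fact r"
      by (intro mult_le_mono) auto
    also have "\<dots> = \<Delta> ^ Suc ?f * ?n ^ (Suc (Suc ?v) - Suc ?f) * fact r"
      using fin by (simp add: Suc_diff_le)
    finally show ?thesis unfolding v' f' r' .
  qed
qed

text \<open>One term of the exponential series at \<open>v\<close>.\<close>

lemma power_le_exp_fact: "real v ^ v \<le> exp (real v) * fact v"
proof -
  have "(\<Sum>k\<in>{v}. inverse (fact k) * real v ^ k) \<le> (\<Sum>k. inverse (fact k) * real v ^ k)"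
    using summable_exp[of "real v"] by (intro sum_le_suminf) auto
  then have "real v ^ v / fact v \<le> exp (real v)"
    by (simp add: exp_def divide_inverse mult.commute)
  then show ?thesis by (simp add: field_simps)
qed

text \<open>Prescribing \<open>v\<close> values of a permutation costs at least a factor
  \<open>n / exp 1\<close> each. This serves the vertices as well as the colours.\<close>

lemma fact_diff_le:
  assumes "v \<le> n" "n > 0"
  shows "real n ^ v * fact (n - v) \<le> exp (real v) * fact n"
proof (cases "v = 0")
  case False
  have "(real n / real v) ^ v \<le> real (n choose v)"
    using binomial_ge_n_over_k_pow_k[OF assms(1), where ?'a = real] False by simp
  then have "real n ^ v \<le> real v ^ v * real (n choose v)"
    using False by (simp add: power_divide field_simps)
  also have "\<dots> \<le> exp (real v) * fact v * real (n choose v)"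
    by (intro mult_right_mono power_le_exp_fact) auto
  finally have "real n ^ v * fact (n - v) \<le> exp (real v) * fact v * real (n choose v) * fact (n - v)"
    by (intro mult_right_mono) auto
  also have "\<dots> = exp (real v) * fact n"
    using arg_cong[OF binomial_fact_lemma[OF assms(1)], of real] by (simp add: algebra_simps)
  finally show ?thesis .
qed simp

lemma card_forest_embeddings_real:
  assumes "forest F" "finite V" "V \<noteq> {}" "F \<subseteq> Pow V"
    and deg: "\<And>v. v \<in> V \<Longrightarrow> card {z\<in>V. {v, z} \<in> E} \<le> \<Delta>"
  shows "real (card (embeddings E V F)) \<le>
    (real \<Delta> * exp 2 / real (card V)) ^ card F * fact (card V)"
proof -
  let ?n = "card V" and ?v = "card (\<Union>F)" and ?f = "card F"
  have n: "?n > 0" using assms by (simp add: card_gt_0_iff)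
  have fv: "?f \<le> ?v" "?v \<le> 2 * ?f" using forest_finite[OF assms(1)] by auto
  have vn: "?v \<le> ?n" using assms by (intro card_mono) auto
  have "real (card (embeddings E V F)) \<le> real (\<Delta> ^ ?f * ?n ^ (?v - ?f) * fact (?n - ?v))"
    using card_forest_embeddings[OF assms(1,2,4) deg] by (simp only: of_nat_le_iff)
  also have "\<dots> = real \<Delta> ^ ?f * (real ?n ^ ?v * fact (?n - ?v)) / real ?n ^ ?f"
  proof -
    have "real ?n ^ (?v - ?f) = real ?n ^ ?v / real ?n ^ ?f" using n fv by (simp add: power_diff)
    then show ?thesis by simp
  qed
  also have "\<dots> \<le> real \<Delta> ^ ?f * (exp (real ?v) * fact ?n) / real ?n ^ ?f"
    using fact_diff_le[OF vn n] by (intro divide_right_mono mult_left_mono) auto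
  also have "\<dots> \<le> real \<Delta> ^ ?f * (exp (real (2 * ?f)) * fact ?n) / real ?n ^ ?f"
    using fv by (intro divide_right_mono mult_left_mono mult_right_mono) auto
  also have "exp (real (2 * ?f)) = exp 2 ^ ?f"
    by (simp add: exp_of_nat_mult[symmetric] mult.commute)
  finally show ?thesis by (simp add: power_mult_distrib power_divide field_simps)
qed

section \<open>Spanning forests\<close>

text \<open>The vertex set is carried along because a one-vertex tree is not visible in its
  edges.\<close>

inductive tree :: "'v set \<Rightarrow> 'v set set \<Rightarrow> bool" where
  singleton: "tree {u} {}"
| grow: "tree A F \<Longrightarrow> x \<in> A \<Longrightarrow> y \<notin> A \<Longrightarrow> tree (insert y A) (insert {x, y} F)"

lemma tree_finite: "tree A F \<Longrightarrow> finite A \<and> finite F \<and> \<Union>F \<subseteq> A \<and> card A = Suc (card F)"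
proof (induction rule: tree.induct)
  case (grow A F x y)
  then have "{x, y} \<notin> F" by auto
  then show ?case using grow by auto
qed simp

text \<open>The growth of the tree is replayed on top of \<open>G\<close>: each new \<open>y\<close>
  is also new to \<open>G\<close>, and the first edge starts a component.\<close>

lemma tree_union_forest: "tree A F \<Longrightarrow> forest G \<Longrightarrow> \<Union>G \<inter> A = {} \<Longrightarrow> forest (F \<union> G)"
proof (induction rule: tree.induct)
  case (grow A F x y)
  have "forest (F \<union> G)" using grow by auto
  moreover have "y \<notin> \<Union>(F \<union> G)" using grow tree_finite[OF grow.hyps(1)] by auto
  ultimately have "forest (insert {x, y} (F \<union> G))" using grow by (intro forest.insert) auto
  then show ?case by simp
qed simp

text \<open>A largest vertex set spanned by a tree inside \<open>T\<close>: an edge with just one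
  end in it would let the tree grow. Keeping the end \<open>u\<close> of an edge in the set forces a
  second vertex.\<close>

lemma ex_component:
  assumes "finite T" "\<And>e. e \<in> T \<Longrightarrow> card e = 2" "T \<noteq> {}"
  obtains A F where "tree A F" "F \<subseteq> T" "A \<subseteq> \<Union>T" "card A \<ge> 2"
    "\<And>e. e \<in> T \<Longrightarrow> e \<subseteq> A \<or> e \<inter> A = {}"
proof -
  obtain u w where uw: "{u, w} \<in> T" "u \<noteq> w" using assms(2,3) by (metis all_not_in_conv card_2_iff)
  have "finite e" if "e \<in> T" for e
    using assms(2)[OF that] by (metis card.infinite zero_neq_numeral)
  then have finU: "finite (\<Union>T)" using assms(1) by blast
  define P where "P A \<longleftrightarrow> u \<in> A \<and> A \<subseteq> \<Union>T \<and> (\<exists>F\<subseteq>T. tree A F)" for A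
  have "P {u}" unfolding P_def using uw singleton[of u] by (auto intro: exI[of _ "{}"])
  moreover have "card A < Suc (card (\<Union>T))" if "P A" for A
    using that finU by (auto simp: P_def less_Suc_eq_le intro: card_mono)
  ultimately obtain A where A: "P A" "\<And>B. P B \<Longrightarrow> card B \<le> card A"
    using ex_has_greatest_nat[of P "{u}" card "Suc (card (\<Union>T))"] by (metis less_imp_le)
  then obtain F where F: "F \<subseteq> T" "tree A F" by (auto simp: P_def)
  have cross: "e \<subseteq> A \<or> e \<inter> A = {}" if e: "e \<in> T" for e
  proof (rule ccontr)
    assume "\<not> ?thesis"
    then obtain x y where xy: "x \<in> e" "x \<in> A" "y \<in> e" "y \<notin> A" by auto
    moreover have "e = {x, y}" using assms(2)[OF e] xy by (auto simp: card_2_iff)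
    ultimately have "tree (insert y A) (insert e F)" "insert e F \<subseteq> T"
      using F e tree.grow[of A F x y] by auto
    then have "P (insert y A)" using A(1) xy(3) e unfolding P_def by blast
    then have "card (insert y A) \<le> card A" by (rule A(2))
    then show False using xy tree_finite[OF F(2)] by simp
  qed
  have "{u, w} \<subseteq> A" using cross[OF uw(1)] A(1) by (auto simp: P_def)
  then have "card A \<ge> card {u, w}" using tree_finite[OF F(2)] by (intro card_mono) auto
  then show ?thesis using that F A(1) cross uw by (simp add: P_def)
qed

text \<open>A component on \<open>s \<ge> 2\<close> vertices has at most \<open>d * s / 2\<close> edges and a spanning tree with
  \<open>s - 1\<close> edges. The trivial bound \<open>s / 2 \<le> s - 1\<close> is sharp for \<open>s = 2\<close> only, when
  there is just one edge; this gives the gain of 4/3 for \<open>d \<ge> 2\<close>, which absorbs all logarithms.\<close>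

lemma ex_large_forest:
  assumes "finite T" "\<And>e. e \<in> T \<Longrightarrow> card e = 2" "d > 0"
    and "\<And>A. A \<subseteq> \<Union>T \<Longrightarrow> 2 * card {e\<in>T. e \<subseteq> A} \<le> d * card A"
  shows "\<exists>F\<subseteq>T. forest F \<and> (if d = 1 then card T \<le> card F else 4 * card T \<le> 3 * d * card F)"
  using assms(1,2,4)
proof (induction "card T" arbitrary: T rule: less_induct)
  case less
  show ?case
  proof (cases "T = {}")
    case True
    then show ?thesis using forest.empty by auto
  next
    case False
    obtain A F where AF: "tree A F" "F \<subseteq> T" "A \<subseteq> \<Union>T" "card A \<ge> 2"
      and cross: "\<And>e. e \<in> T \<Longrightarrow> e \<subseteq> A \<or> e \<inter> A = {}"
      using ex_component[OF less.prems(1,2) False] by metis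
    define T1 T' where "T1 = {e\<in>T. e \<subseteq> A}" and "T' = {e\<in>T. e \<inter> A = {}}"
    have ne: "e \<noteq> {}" if "e \<in> T" for e using less.prems(2)[OF that] by auto
    have T: "T = T1 \<union> T'" using cross by (auto simp: T1_def T'_def)
    have "e = {}" if "e \<in> T1 \<inter> T'" for e using that by (auto simp: T1_def T'_def)
    then have disj: "T1 \<inter> T' = {}" using ne T by blast
    have fin: "finite T1" "finite T'" using less.prems(1) by (auto simp: T1_def T'_def)
    have cT: "card T = card T1 + card T'" using T disj fin by (simp add: card_Un_disjoint)
    have treeA: "finite A" "card A = Suc (card F)" "finite F" "\<Union>F \<subseteq> A"
      using tree_finite[OF AF(1)] by auto
    have "F \<subseteq> T1" using AF treeA by (auto simp: T1_def)
    then have "card F \<le> card T1" using fin by (intro card_mono) auto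
    then have "card T' < card T" using cT AF(4) treeA by simp
    then have "\<exists>F\<subseteq>T'. forest F \<and> (if d = 1 then card T' \<le> card F else 4 * card T' \<le> 3 * d * card F)"
    proof (rule less.hyps)
      fix B assume B: "B \<subseteq> \<Union>T'"
      have "card {e\<in>T'. e \<subseteq> B} \<le> card {e\<in>T. e \<subseteq> B}"
        using less.prems(1) by (intro card_mono) (auto simp: T'_def)
      moreover have "2 * card {e\<in>T. e \<subseteq> B} \<le> d * card B"
        using B by (intro less.prems(3)) (auto simp: T'_def)
      ultimately show "2 * card {e\<in>T'. e \<subseteq> B} \<le> d * card B" by linarith
    qed (use less.prems in \<open>auto simp: T'_def\<close>)
    then obtain F' where F': "F' \<subseteq> T'" "forest F'"
      "if d = 1 then card T' \<le> card F' else 4 * card T' \<le> 3 * d * card F'" by auto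
    have forest: "forest (F \<union> F')"
      using F' by (intro tree_union_forest[OF AF(1)]) (auto simp: T'_def)
    have "F \<inter> F' = {}" using \<open>F \<subseteq> T1\<close> F'(1) disj by auto
    then have cF: "card (F \<union> F') = card F + card F'"
      using treeA F' fin finite_subset by (intro card_Un_disjoint) auto
    have dens: "2 * card T1 \<le> d * card A" unfolding T1_def using AF(3) by (rule less.prems(3))
    have "if d = 1 then card T1 \<le> card F else 4 * card T1 \<le> 3 * d * card F"
    proof (cases "d = 1")
      case True
      then show ?thesis using dens treeA AF(4) by simp
    next
      case False
      then have d2: "d \<ge> 2" using assms(3) by simp
      show ?thesis
      proof (cases "card F = 1")
        \<comment> \<open>A single edge, for which the claim reads
          \<open>4 \<le> 3 * d\<close>.\<close>
        case True
        have "e = A" if "e \<in> T1" for e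
          using that less.prems(2)[of e] treeA True by (intro card_subset_eq) (auto simp: T1_def)
        then have "card T1 \<le> card {A}" by (intro card_mono) auto
        then show ?thesis using True False d2 by simp
      next
        case neq: False
        \<comment> \<open>This is \<open>2 * s \<le> 3 * (s - 1)\<close> for
          \<open>s \<ge> 3\<close> vertices, with equality at \<open>s = 3\<close>: the source of
          the 4/3.\<close>
        then have "2 * Suc (card F) \<le> 3 * card F" using AF(4) treeA by simp
        then have "d * (2 * Suc (card F)) \<le> d * (3 * card F)" by (rule mult_le_mono2)
        moreover have "4 * card T1 \<le> d * (2 * Suc (card F))" using dens treeA by simp
        ultimately have "4 * card T1 \<le> d * (3 * card F)" by (rule order_trans[rotated])
        then show ?thesis using False by (simp add: mult_ac)
      qed
    qed
    then have "if d = 1 then card T \<le> card (F \<union> F') else 4 * card T \<le> 3 * d * card (F \<union> F')"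
      using F'(3) cT cF by (simp add: algebra_simps split: if_splits)
    moreover have "F \<union> F' \<subseteq> T" using AF(2) F'(1) by (auto simp: T'_def)
    ultimately show ?thesis using forest by blast
  qed
qed

section \<open>Spread of the coloured copies\<close>

text \<open>Composition with the inverse of one member makes all members fix \<open>A\<close>
  pointwise.\<close>

lemma card_agreeing_permutations:
  assumes "finite C" "A \<subseteq> C" "\<And>\<sigma>. \<sigma> \<in> R \<Longrightarrow> \<sigma> permutes C"
    and agree: "\<And>\<sigma> \<tau> a. \<sigma> \<in> R \<Longrightarrow> \<tau> \<in> R \<Longrightarrow> a \<in> A \<Longrightarrow> \<sigma> a = \<tau> a"
  shows "card R \<le> fact (card C - card A)"
proof (cases "R = {}")
  case False
  then obtain \<tau> where \<tau>: "\<tau> \<in> R" by auto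
  have t: "\<tau> permutes C" using assms(3) \<tau> .
  have "card R \<le> card {\<sigma>. \<sigma> permutes (C - A)}"
  proof (rule card_inj_on_le)
    show "inj_on (\<lambda>\<sigma>. inv \<tau> \<circ> \<sigma>) R"
      by (rule inj_onI) (metis comp_assoc permutes_inv_o(1)[OF t] id_comp)
    show "(\<lambda>\<sigma>. inv \<tau> \<circ> \<sigma>) ` R \<subseteq> {\<sigma>. \<sigma> permutes (C - A)}"
    proof clarify
      fix \<sigma> assume \<sigma>: "\<sigma> \<in> R"
      have "inv \<tau> \<circ> \<sigma> permutes C" using assms(3)[OF \<sigma>] permutes_inv[OF t] by (rule permutes_compose)
      then show "inv \<tau> \<circ> \<sigma> permutes C - A"
      proof (rule permutes_superset)
        fix x assume "x \<in> C - (C - A)"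
        then have "\<sigma> x = \<tau> x" using agree \<sigma> \<tau> by auto
        then show "(inv \<tau> \<circ> \<sigma>) x = x" using permutes_inverses(2)[OF t] by simp
      qed
    qed
  qed (use assms in \<open>auto intro: finite_permutations\<close>)
  also have "\<dots> = fact (card C - card A)"
    using assms by (subst card_permutations) (auto simp: card_Diff_subset finite_subset)
  finally show ?thesis .
qed simp

text \<open>The permutation \<open>\<pi>\<close> maps the copy back to the graph with edge set \<open>E\<close>.\<close>

definition colored_copy :: "'v set set \<Rightarrow> ('v set \<Rightarrow> nat) \<Rightarrow> ('v \<Rightarrow> 'v) \<Rightarrow> (nat \<Rightarrow> nat) \<Rightarrow> ('v set \<times> nat) set"
  where "colored_copy E lab \<pi> \<sigma> = {(e, \<sigma> (lab (\<pi> ` e))) | e. \<pi> ` e \<in> E}"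

text \<open>The count factorises. The edges of \<open>T\<close> have to be embedded by
  \<open>\<pi>\<close>, which gives \<open>\<beta> powr x\<close> per edge through a large forest;
  given \<open>\<pi>\<close>, the permutation \<open>\<sigma>\<close> is prescribed on
  \<open>card T\<close> colours, which gives \<open>exp 1 / card C\<close> each.\<close>

lemma colored_copy_spread:
  fixes V :: "'v set" and d \<Delta> :: nat
  defines "x \<equiv> (if d = 1 then 1 else 4 / (3 * real d))"
    and "\<beta> \<equiv> real \<Delta> * exp 2 / real (card V)"
  assumes V: "finite V" "V \<noteq> {}" and E: "\<And>e. e \<in> E \<Longrightarrow> e \<subseteq> V \<and> card e = 2"
    and deg: "\<And>v. v \<in> V \<Longrightarrow> card {z\<in>V. {v, z} \<in> E} \<le> \<Delta>"
    and dens: "\<And>A. A \<subseteq> V \<Longrightarrow> 2 * card {e\<in>E. e \<subseteq> A} \<le> d * card A"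
    and d: "d > 0" "\<Delta> > 0" "\<beta> \<le> 1"
    and C: "finite C" "C \<noteq> {}" "inj_on lab E" "lab ` E \<subseteq> C"
    and T: "finite T"
  defines "I \<equiv> {\<pi>. \<pi> permutes V} \<times> {\<sigma>. \<sigma> permutes C}"
  shows "real (card {i\<in>I. T \<subseteq> colored_copy E lab (fst i) (snd i)}) \<le>
    (exp 1 / real (card C) * \<beta> powr x) ^ card T * card I"
proof (cases "{i\<in>I. T \<subseteq> colored_copy E lab (fst i) (snd i)} = {}")
  case True
  show ?thesis unfolding True by (simp add: \<beta>_def)
next
  case False
  \<comment> \<open>A single copy containing \<open>T\<close> shows that \<open>T\<close> has one
    colour per edge, at most \<open>card C\<close> elements, and inherits the density bound of
    \<open>E\<close>.\<close>
  then obtain \<pi>0 \<sigma>0 where 0: "\<pi>0 permutes V" "\<sigma>0 permutes C" "T \<subseteq> colored_copy E lab \<pi>0 \<sigma>0"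
    by (auto simp: I_def)
  let ?n = "card V" and ?c = "card C" and ?k = "card T"
  define F where "F = fst ` T"
  have n: "?n > 0" and c: "?c > 0" using V C by (auto simp: card_gt_0_iff)
  have \<beta>0: "\<beta> > 0" using n d by (simp add: \<beta>_def)
  have inj_img: "inj_on (\<lambda>e. \<pi> ` e) X" if "\<pi> permutes V" for \<pi> :: "'v \<Rightarrow> 'v" and X
    using permutes_inj[OF that] by (auto intro!: inj_onI simp: inj_image_eq_iff)
  have lab_inj: "inj_on (\<lambda>e. lab (\<pi> ` e)) X"
    if "\<pi> permutes V" "\<And>e. e \<in> X \<Longrightarrow> \<pi> ` e \<in> E" for \<pi> X
  proof -
    have "inj_on lab ((\<lambda>e. \<pi> ` e) ` X)" using that(2) by (intro inj_on_subset[OF C(3)]) auto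
    from comp_inj_on[OF inj_img[OF that(1)] this] show ?thesis by (simp add: comp_def)
  qed
  have TD: "\<pi> ` e \<in> E \<and> j = \<sigma> (lab (\<pi> ` e))" if "T \<subseteq> colored_copy E lab \<pi> \<sigma>" "(e, j) \<in> T" for \<pi> \<sigma> e j
    using that by (auto simp: colored_copy_def)
  have injT: "inj_on fst T"
  proof (rule inj_onI)
    fix a b assume "a \<in> T" "b \<in> T" "fst a = fst b"
    then show "a = b"
      using TD[OF 0(3), of "fst a" "snd a"] TD[OF 0(3), of "fst b" "snd b"]
      by (cases a; cases b) simp
  qed
  have cF: "card F = ?k" unfolding F_def by (rule card_image[OF injT])
  have finF: "finite F" using T by (simp add: F_def)
  have FE: "\<pi>0 ` e \<in> E" if "e \<in> F" for e using that TD[OF 0(3)] by (auto simp: F_def)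
  have F2: "e \<subseteq> V \<and> card e = 2" if "e \<in> F" for e
  proof -
    have "inj_on \<pi>0 e" using permutes_inj[OF 0(1)] by (rule inj_on_subset) auto
    then have "card e = 2" using E[OF FE[OF that]] by (simp add: card_image)
    moreover have "e \<subseteq> V" using E[OF FE[OF that]] permutes_in_image[OF 0(1)] by blast
    ultimately show ?thesis by simp
  qed
  have "\<exists>F'\<subseteq>F. forest F' \<and> (if d = 1 then card F \<le> card F' else 4 * card F \<le> 3 * d * card F')"
  proof (rule ex_large_forest[OF finF])
    fix A assume "A \<subseteq> \<Union>F"
    then have AV: "A \<subseteq> V" using F2 by blast
    have "card {e\<in>F. e \<subseteq> A} \<le> card {e\<in>E. e \<subseteq> \<pi>0 ` A}"
    proof (rule card_inj_on_le[OF inj_img[OF 0(1)]])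
      show "(\<lambda>e. \<pi>0 ` e) ` {e\<in>F. e \<subseteq> A} \<subseteq> {e\<in>E. e \<subseteq> \<pi>0 ` A}" using FE by auto
      have "E \<subseteq> Pow V" using E by auto
      then show "finite {e\<in>E. e \<subseteq> \<pi>0 ` A}" using V by (auto intro: finite_subset)
    qed
    moreover have "2 * card {e\<in>E. e \<subseteq> \<pi>0 ` A} \<le> d * card (\<pi>0 ` A)"
      using AV permutes_in_image[OF 0(1)] by (intro dens) auto
    moreover have "card (\<pi>0 ` A) = card A"
      using permutes_inj[OF 0(1)] by (intro card_image) (auto intro: inj_on_subset)
    ultimately show "2 * card {e\<in>F. e \<subseteq> A} \<le> d * card A" by simp
  qed (use F2 d in auto)
  then obtain F' where F': "F' \<subseteq> F" "forest F'"
    "if d = 1 then card F \<le> card F' else 4 * card F \<le> 3 * d * card F'" by auto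
  have xk: "x * ?k \<le> card F'"
  proof (cases "d = 1")
    case False
    then have "4 * ?k \<le> 3 * d * card F'" using F'(3) cF by simp
    then have "real (4 * ?k) \<le> real (3 * d * card F')" by (simp only: of_nat_le_iff)
    then show ?thesis using False d by (simp add: x_def field_simps)
  qed (use F'(3) cF in \<open>simp add: x_def\<close>)
  define R where "R \<pi> = {\<sigma>. \<sigma> permutes C \<and> T \<subseteq> colored_copy E lab \<pi> \<sigma>}" for \<pi>
  have kc: "?k \<le> ?c"
  proof -
    have "inj_on (\<lambda>e. lab (\<pi>0 ` e)) F" by (rule lab_inj[OF 0(1) FE])
    moreover have "(\<lambda>e. lab (\<pi>0 ` e)) ` F \<subseteq> C" using C FE by auto
    ultimately show ?thesis using C(1) cF by (metis card_inj_on_le)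
  qed
  have cR: "card (R \<pi>) \<le> fact (?c - ?k)" if \<pi>: "\<pi> \<in> embeddings E V F" for \<pi>
  proof -
    have \<pi>E: "\<pi> ` e \<in> E" if "e \<in> F" for e using \<pi> that by (simp add: embeddings_def)
    have pV: "\<pi> permutes V" using \<pi> by (simp add: embeddings_def)
    have "inj_on (\<lambda>e. lab (\<pi> ` e)) F" by (rule lab_inj[OF pV \<pi>E])
    then have "card ((\<lambda>e. lab (\<pi> ` e)) ` F) = ?k" using cF by (simp add: card_image)
    moreover have "card (R \<pi>) \<le> fact (?c - card ((\<lambda>e. lab (\<pi> ` e)) ` F))"
    proof (rule card_agreeing_permutations[OF C(1)])
      show "(\<lambda>e. lab (\<pi> ` e)) ` F \<subseteq> C" using C \<pi>E by auto
      show "\<sigma> permutes C" if "\<sigma> \<in> R \<pi>" for \<sigma> using that by (simp add: R_def)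
      fix \<sigma> \<tau> a assume st: "\<sigma> \<in> R \<pi>" "\<tau> \<in> R \<pi>" "a \<in> (\<lambda>e. lab (\<pi> ` e)) ` F"
      then obtain e j where "(e, j) \<in> T" "a = lab (\<pi> ` e)" by (auto simp: F_def)
      then show "\<sigma> a = \<tau> a" using st(1,2) TD[of \<pi> \<sigma> e j] TD[of \<pi> \<tau> e j] by (simp add: R_def)
    qed
    ultimately show ?thesis by simp
  qed
  have sub: "{i\<in>I. T \<subseteq> colored_copy E lab (fst i) (snd i)} \<subseteq> Sigma (embeddings E V F) R"
  proof
    fix i assume i: "i \<in> {i\<in>I. T \<subseteq> colored_copy E lab (fst i) (snd i)}"
    then have "fst i ` e \<in> E" if "e \<in> F" for e
      using that TD[of "fst i" "snd i"] by (auto simp: F_def)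
    then show "i \<in> Sigma (embeddings E V F) R"
      using i by (cases i) (auto simp: I_def R_def embeddings_def)
  qed
  have finR: "finite (R \<pi>)" for \<pi>
    unfolding R_def using C(1) by (intro finite_subset[OF _ finite_permutations[of C]]) auto
  have "card {i\<in>I. T \<subseteq> colored_copy E lab (fst i) (snd i)} \<le> card (Sigma (embeddings E V F) R)"
    using finite_embeddings[OF V(1)] finR by (intro card_mono[OF _ sub]) auto
  also have "\<dots> = (\<Sum>\<pi>\<in>embeddings E V F. card (R \<pi>))"
    using finite_embeddings[OF V(1)] finR by (intro card_SigmaI) auto
  also have "\<dots> \<le> (\<Sum>\<pi>\<in>embeddings E V F. fact (?c - ?k))"
    by (rule sum_mono) (rule cR)
  also have "\<dots> = card (embeddings E V F) * fact (?c - ?k)" by simp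
  \<comment> \<open>Edges outside the forest are simply dropped from the requirements.\<close>
  also have "\<dots> \<le> card (embeddings E V F') * fact (?c - ?k)"
    using F'(1) finite_embeddings[OF V(1)]
    by (intro mult_right_mono card_mono) (auto simp: embeddings_def)
  finally have "real (card {i\<in>I. T \<subseteq> colored_copy E lab (fst i) (snd i)}) \<le>
      real (card (embeddings E V F') * fact (?c - ?k))" by (simp only: of_nat_le_iff)
  also have "\<dots> = real (card (embeddings E V F')) * fact (?c - ?k)" by simp
  also have "\<dots> \<le> ((\<beta> powr x) ^ ?k * fact ?n) * ((exp 1 / real ?c) ^ ?k * fact ?c)"
  proof (rule mult_mono)
    have "F' \<subseteq> Pow V" using F' F2 by auto
    then have "real (card (embeddings E V F')) \<le> \<beta> ^ card F' * fact ?n"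
      unfolding \<beta>_def by (intro card_forest_embeddings_real F' V deg)
    also have "\<beta> ^ card F' = \<beta> powr real (card F')" using \<beta>0 by (simp add: powr_realpow)
    \<comment> \<open>Here \<open>\<beta> \<le> 1\<close> matters: more forest edges make the bound
      smaller.\<close>
    also have "\<dots> \<le> \<beta> powr (x * ?k)" using xk \<beta>0 d(3) by (intro powr_mono') auto
    also have "\<dots> = (\<beta> powr x) ^ ?k" using \<beta>0 by (simp add: powr_powr[symmetric] powr_realpow)
    finally show "real (card (embeddings E V F')) \<le> (\<beta> powr x) ^ ?k * fact ?n" by simp
    have "real ?c ^ ?k * fact (?c - ?k) \<le> exp (real ?k) * fact ?c" by (rule fact_diff_le[OF kc c])
    also have "exp (real ?k) = exp 1 ^ ?k" by (simp add: exp_of_nat_mult[symmetric])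
    finally show "fact (?c - ?k) \<le> (exp 1 / real ?c) ^ ?k * fact ?c"
      using c by (simp add: power_divide field_simps)
  qed auto
  also have "\<dots> = (exp 1 / real ?c * \<beta> powr x) ^ ?k * real (card I)"
    using V(1) C(1) by (simp add: I_def card_cartesian_product card_permutations power_mult_distrib power_divide)
  finally show ?thesis .
qed

section \<open>Rainbow copies\<close>

lemma random_colored_graph_support:
  assumes "x \<in> set_pmf (random_colored_graph c n p)"
  shows "verts (fst x) = {1..n} \<and> edges (fst x) \<subseteq> vertex_pairs n"
  using assms by (auto simp: random_colored_graph_def random_graph_def)

lemma map_random_colored_graph:
  "map_pmf (\<lambda>(G, col). {(e, col e) | e. e \<in> edges G}) (random_colored_graph c n p) =
    colored_subset c p (vertex_pairs n)"
  by (simp add: random_colored_graph_def random_graph_def colored_subset_def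
      map_bind_pmf bind_map_pmf map_pmf_comp)

lemma finite_vertex_pairs: "finite (vertex_pairs n)"
  by (rule finite_subset[of _ "Pow {1..n}"]) (auto simp: vertex_pairs_def)

lemma card_vertex_pairs_le: "card (vertex_pairs n) \<le> n\<^sup>2"
proof -
  have "card (vertex_pairs n) = n choose 2"
    using n_subsets[of "{1..n}" 2] by (simp add: vertex_pairs_def)
  also have "\<dots> \<le> n\<^sup>2"
    by (cases "2 \<le> n") (auto intro: binomial_le_pow simp: binomial_eq_0)
  finally show ?thesis .
qed

lemma degree_le_max_degree:
  assumes "finite (verts H)" "v \<in> verts H"
  shows "degree H v \<le> max_degree H"
  unfolding max_degree_def using assms by (intro Max_ge) auto

text \<open>The subgraph induced on \<open>A\<close> competes in the maximum; most of the work is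
  the finiteness that \<open>Max\<close> requires.\<close>

lemma card_edges_within_le:
  assumes "simple_graph H" "A \<subseteq> verts H"
  shows "2 * real (card {e\<in>edges H. e \<subseteq> A}) \<le> max_density H * real (card A)"
proof (cases "A = {}")
  case True
  have "{e\<in>edges H. e \<subseteq> A} = {}" using assms(1) True by (auto simp: simple_graph_def)
  then show ?thesis using True by simp
next
  case False
  let ?D = "{2 * real (card (edges K)) / real (card (verts K)) | K. subgraph K H \<and> verts K \<noteq> {}}"
  let ?K = "(A, {e\<in>edges H. e \<subseteq> A})"
  have fin: "finite (verts H)" using assms by (simp add: simple_graph_def)
  have "edges H \<subseteq> Pow (verts H)" using assms by (auto simp: simple_graph_def)
  then have finE: "finite (edges H)" using fin by (auto intro: finite_subset)
  have "{K. subgraph K H} \<subseteq> Pow (verts H) \<times> Pow (edges H)" by (auto simp: subgraph_def)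
  then have "finite {K. subgraph K H}" using fin finE by (auto intro: finite_subset)
  then have "finite ((\<lambda>K. 2 * real (card (edges K)) / real (card (verts K))) ` {K. subgraph K H})"
    by (rule finite_imageI)
  then have finD: "finite ?D" by (rule finite_subset[rotated]) blast
  have finA: "finite A" using fin assms by (auto intro: finite_subset)
  have "subgraph ?K H" using assms finA by (auto simp: subgraph_def simple_graph_def)
  then have "2 * real (card (edges ?K)) / real (card (verts ?K)) \<in> ?D" using False by force
  then have "2 * real (card (edges ?K)) / real (card (verts ?K)) \<le> max_density H"
    unfolding max_density_def using finD by (intro Max_ge)
  moreover have "card A > 0" using False finA by (simp add: card_gt_0_iff)
  ultimately show ?thesis by (simp add: field_simps)
qed

lemma colored_copy_subset:
  assumes "\<pi> permutes V" "\<sigma> permutes C" "lab ` E \<subseteq> C"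
    and E: "\<And>e. e \<in> E \<Longrightarrow> e \<subseteq> V \<and> card e = 2"
  shows "colored_copy E lab \<pi> \<sigma> \<subseteq> {e. e \<subseteq> V \<and> card e = 2} \<times> C"
proof
  fix z assume "z \<in> colored_copy E lab \<pi> \<sigma>"
  then obtain e where z: "z = (e, \<sigma> (lab (\<pi> ` e)))" "\<pi> ` e \<in> E" by (auto simp: colored_copy_def)
  have "card (\<pi> ` e) = card e"
    using permutes_inj[OF assms(1)] by (intro card_image) (auto intro: inj_on_subset)
  moreover have "e \<subseteq> V"
  proof
    fix v assume "v \<in> e"
    then have "\<pi> v \<in> V" using E[OF z(2)] by auto
    then show "v \<in> V" using permutes_in_image[OF assms(1)] by simp
  qed
  moreover have "\<sigma> (lab (\<pi> ` e)) \<in> C" using assms(3) z(2) permutes_in_image[OF assms(2)] by auto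
  ultimately show "z \<in> {e. e \<subseteq> V \<and> card e = 2} \<times> C" using z E[OF z(2)] by auto
qed

text \<open>The copy is the preimage of \<open>E\<close> under \<open>\<pi>\<close>, reached from
  \<open>H\<close> by \<open>inv \<pi> \<circ> b\<close>; its colours are distinct as
  \<open>\<sigma>\<close> and \<open>lab\<close> are injective.\<close>

lemma colored_copy_rainbow:
  assumes b: "bij_betw b (verts H) V" and fin: "finite V"
    and \<pi>: "\<pi> permutes V" and \<sigma>: "\<sigma> permutes C"
    and E: "E = (\<lambda>e. b ` e) ` edges H" "\<And>e. e \<in> E \<Longrightarrow> e \<subseteq> V \<and> card e = 2"
    and lab: "inj_on lab E" "lab ` E \<subseteq> C"
    and G: "verts G = V" "colored_copy E lab \<pi> \<sigma> \<subseteq> {(e, col e) | e. e \<in> edges G}"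
  shows "contains_rainbow_copy H (G, col)"
proof -
  let ?K = "(V, {e. \<pi> ` e \<in> E})"
  have in_copy: "(e, \<sigma> (lab (\<pi> ` e))) \<in> colored_copy E lab \<pi> \<sigma>" if "\<pi> ` e \<in> E" for e
    using that by (auto simp: colored_copy_def)
  have col: "e \<in> edges G \<and> col e = \<sigma> (lab (\<pi> ` e))" if "\<pi> ` e \<in> E" for e
    using G(2) in_copy[OF that] by auto
  have sub: "e \<subseteq> V \<and> card e = 2" if "\<pi> ` e \<in> E" for e
    using colored_copy_subset[OF \<pi> \<sigma> lab(2) E(2)] in_copy[OF that] by auto
  have "subgraph ?K G" using fin sub col G(1) by (auto simp: subgraph_def simple_graph_def)
  moreover have "isomorphic H ?K"
  proof -
    have "bij_betw (inv \<pi> \<circ> b) (verts H) (verts ?K)"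
      using bij_betw_trans[OF b permutes_imp_bij[OF permutes_inv[OF \<pi>]]] by simp
    moreover have "edges ?K = (\<lambda>e. (inv \<pi> \<circ> b) ` e) ` edges H"
    proof (intro equalityI subsetI)
      fix e assume "e \<in> edges ?K"
      then obtain e0 where e0: "e0 \<in> edges H" "\<pi> ` e = b ` e0" using E(1) by auto
      have "e = inv \<pi> ` (\<pi> ` e)"
        by (simp add: image_comp permutes_inv_o(2)[OF \<pi>])
      then have "e = (inv \<pi> \<circ> b) ` e0" by (simp only: e0(2) image_comp)
      then show "e \<in> (\<lambda>e. (inv \<pi> \<circ> b) ` e) ` edges H" using e0(1) by auto
    next
      fix e assume "e \<in> (\<lambda>e. (inv \<pi> \<circ> b) ` e) ` edges H"
      then obtain e0 where e0: "e0 \<in> edges H" "e = inv \<pi> ` (b ` e0)" by (auto simp: image_comp)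
      then have "\<pi> ` e = b ` e0"
        by (simp add: image_image permutes_inverses(1)[OF \<pi>])
      then show "e \<in> edges ?K" using e0(1) E(1) by auto
    qed
    ultimately show ?thesis unfolding isomorphic_def by blast
  qed
  moreover have "inj_on col (edges ?K)"
  proof (rule inj_onI)
    fix e e' assume "e \<in> edges ?K" "e' \<in> edges ?K" and eq: "col e = col e'"
    then have ee': "\<pi> ` e \<in> E" "\<pi> ` e' \<in> E" by auto
    then have "\<sigma> (lab (\<pi> ` e)) = \<sigma> (lab (\<pi> ` e'))" using col eq by metis
    then have "lab (\<pi> ` e) = lab (\<pi> ` e')" using permutes_inj[OF \<sigma>] by (simp add: inj_eq)
    then have "\<pi> ` e = \<pi> ` e'" using lab(1) ee' by (auto dest: inj_onD)
    then show "e = e'" using permutes_inj[OF \<pi>] by (simp add: inj_image_eq_iff)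
  qed
  ultimately show ?thesis unfolding contains_rainbow_copy_def by auto
qed

text \<open>The quantitative form for one \<open>n\<close>. The last assumption says that
  \<open>m\<close> rounds of density \<open>q = L * \<theta>\<close> satisfy
  \<open>m * q \<le> p / c\<close>, which is what the exchange of independent for exclusive colours
  demands.\<close>

lemma prob_rainbow_copy_ge:
  fixes d \<Delta> n m c :: nat and L p :: real and H :: "'a graph"
  defines "x \<equiv> (if d = 1 then 1 else 4 / (3 * real d))"
    and "\<beta> \<equiv> real \<Delta> * exp 2 / real n"
  assumes H: "H \<in> graph_family n \<Delta> (real d)" and c: "c > 0" "card (edges H) \<le> c"
    and pos: "n > 0" "d > 0" "\<Delta> > 0" and \<beta>: "\<beta> \<le> 1"
    and p: "p \<le> 1" and L: "L \<ge> 4" and m: "m > 0" "n\<^sup>2 < 2 ^ m"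
    and mL: "real m * L * exp 1 * \<beta> powr x \<le> p"
  shows "1 - 4 * real m / L \<le>
    measure_pmf.prob (random_colored_graph c n p) {G. contains_rainbow_copy H G}"
proof -
  define V where "V = {1..n}"
  define C where "C = {1..c}"
  define \<theta> where "\<theta> = exp 1 / real c * \<beta> powr x"
  define q where "q = L * \<theta>"
  define X where "X = vertex_pairs n \<times> C"
  have H': "simple_graph H" "card (verts H) = n" "max_degree H \<le> \<Delta>" "max_density H \<le> d"
    using H by (auto simp: graph_family_def)
  have finH: "finite (verts H)" using H' by (simp add: simple_graph_def)
  have EH: "e \<subseteq> verts H \<and> card e = 2" if "e \<in> edges H" for e
    using that H' by (simp add: simple_graph_def)
  then have finEH: "finite (edges H)" using finH by (auto intro: finite_subset[of _ "Pow (verts H)"])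
  obtain b where b: "bij_betw b (verts H) V"
    using finite_same_card_bij[of "verts H" V] finH H' by (auto simp: V_def)
  define E where "E = (\<lambda>e. b ` e) ` edges H"
  have b_inj: "inj_on b (verts H)" and b_img: "b ` verts H = V" using b by (auto simp: bij_betw_def)
  have E: "e \<subseteq> V \<and> card e = 2" if eE: "e \<in> E" for e
  proof -
    obtain e0 where e0: "e0 \<in> edges H" "e = b ` e0" using eE by (auto simp: E_def)
    then have "card e = card e0" using EH[OF e0(1)] b_inj
      by (simp add: card_image inj_on_subset)
    then show ?thesis using EH[OF e0(1)] e0 b_img by auto
  qed
  have deg: "card {z\<in>V. {v, z} \<in> E} \<le> \<Delta>" if v: "v \<in> V" for v
  proof -
    obtain u where u: "u \<in> verts H" "v = b u" using v b_img by auto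
    have "card {z\<in>V. {v, z} \<in> E} \<le> card ((\<lambda>e. b ` e) ` {e\<in>edges H. u \<in> e})"
    proof (rule card_inj_on_le)
      show "inj_on (\<lambda>z. {v, z}) {z\<in>V. {v, z} \<in> E}" by (auto intro!: inj_onI simp: doubleton_eq_iff)
      show "(\<lambda>z. {v, z}) ` {z\<in>V. {v, z} \<in> E} \<subseteq> (\<lambda>e. b ` e) ` {e\<in>edges H. u \<in> e}"
      proof clarify
        fix z assume "{v, z} \<in> E"
        then obtain e where e: "e \<in> edges H" "{v, z} = b ` e" by (auto simp: E_def)
        then obtain w where w: "w \<in> e" "b w = b u" using u by (metis imageE insertI1)
        then have "w = u" using b_inj EH[OF e(1)] u(1) by (auto dest: inj_onD)
        then show "{v, z} \<in> (\<lambda>e. b ` e) ` {e\<in>edges H. u \<in> e}" using e w by auto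
      qed
    qed (use finEH in auto)
    also have "\<dots> \<le> card {e\<in>edges H. u \<in> e}" using finEH by (intro card_image_le) auto
    also have "\<dots> \<le> max_degree H" using degree_le_max_degree[OF finH u(1)] by (simp add: degree_def)
    finally show ?thesis using H' by simp
  qed
  have dens: "2 * card {e\<in>E. e \<subseteq> A} \<le> d * card A" if A: "A \<subseteq> V" for A
  proof -
    define A' where "A' = {v\<in>verts H. b v \<in> A}"
    have "b ` A' = A" using A b_img by (auto simp: A'_def)
    then have cA: "card A' = card A"
      using card_image[of b A'] b_inj inj_on_subset[of b "verts H" A'] by (auto simp: A'_def)
    have "{e\<in>E. e \<subseteq> A} \<subseteq> (\<lambda>e. b ` e) ` {e\<in>edges H. e \<subseteq> A'}"
    proof
      fix e assume "e \<in> {e\<in>E. e \<subseteq> A}"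
      then obtain e0 where "e0 \<in> edges H" "e = b ` e0" "b ` e0 \<subseteq> A" by (auto simp: E_def)
      moreover from this have "e0 \<subseteq> A'" using EH by (auto simp: A'_def)
      ultimately show "e \<in> (\<lambda>e. b ` e) ` {e\<in>edges H. e \<subseteq> A'}" by auto
    qed
    then have "card {e\<in>E. e \<subseteq> A} \<le> card ((\<lambda>e. b ` e) ` {e\<in>edges H. e \<subseteq> A'})"
      using finEH by (intro card_mono) auto
    also have "\<dots> \<le> card {e\<in>edges H. e \<subseteq> A'}" using finEH by (intro card_image_le) auto
    finally have "2 * real (card {e\<in>E. e \<subseteq> A}) \<le> 2 * real (card {e\<in>edges H. e \<subseteq> A'})" by simp
    also have "\<dots> \<le> max_density H * real (card A')"
      using H'(1) by (intro card_edges_within_le) (auto simp: A'_def)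
    also have "\<dots> \<le> real d * real (card A)" unfolding cA using H' by (intro mult_right_mono) auto
    finally have "real (2 * card {e\<in>E. e \<subseteq> A}) \<le> real (d * card A)" by simp
    then show ?thesis by (simp only: of_nat_le_iff)
  qed
  have "card E \<le> card C" unfolding E_def C_def using card_image_le[OF finEH, of "\<lambda>e. b ` e"] c(2) by simp
  moreover have "finite E" using finEH by (simp add: E_def)
  ultimately obtain lab where lab: "inj_on lab E" "lab ` E \<subseteq> C"
    using inj_on_iff_card_le[of E C] by (auto simp: C_def)
  define I where "I = {\<pi>. \<pi> permutes V} \<times> {\<sigma>. \<sigma> permutes C}"
  define f where "f i = colored_copy E lab (fst i) (snd i)" for i :: "(nat \<Rightarrow> nat) \<times> (nat \<Rightarrow> nat)"
  define g :: "(nat set \<times> nat) set \<Rightarrow> real" where "g U = (if \<exists>S\<in>f ` I. S \<subseteq> U then 0 else 1)" for U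
  have finX: "finite X" by (simp add: X_def C_def finite_vertex_pairs)
  have \<beta>0: "\<beta> > 0" using pos by (simp add: \<beta>_def)
  have \<theta>0: "\<theta> > 0" using \<beta>0 c by (simp add: \<theta>_def)
  have q0: "q > 0" using \<theta>0 L by (simp add: q_def)
  have mq: "real m * q \<le> p / c"
  proof -
    have "real m * q = real m * L * exp 1 * \<beta> powr x / c" by (simp add: q_def \<theta>_def)
    then show ?thesis using mL by (simp add: divide_right_mono)
  qed
  have "0 \<le> p" using mL L by (meson exp_ge_zero mult_nonneg_nonneg of_nat_0_le_iff order_trans powr_ge_zero zero_le_numeral)
  have "p / c \<le> 1" using p c by simp
  moreover have "1 * q \<le> real m * q" using m q0 by (intro mult_right_mono) auto
  ultimately have q1: "q \<le> 1" using mq by linarith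
  have single: "i = j" if "S \<in> f ` I" "(e, i) \<in> S" "(e, j) \<in> S" for S e i j
    using that by (auto simp: f_def colored_copy_def)
  have subX: "f i \<subseteq> X" if "i \<in> I" for i
  proof -
    have "X = {e. e \<subseteq> V \<and> card e = 2} \<times> C" by (simp add: X_def V_def vertex_pairs_def)
    then show ?thesis
      using that colored_copy_subset[OF _ _ lab(2) E, of "fst i" "snd i"]
      by (simp add: f_def I_def mem_Times_iff)
  qed
  have "miss_prob q X m (f ` I) \<le> 4 * real m / L"
  proof (rule spread_miss_prob[OF finX q_def q1 \<theta>0 L])
    show "finite I" unfolding I_def V_def C_def by (intro finite_cartesian_product finite_permutations) auto
    show "I \<noteq> {}" unfolding I_def using permutes_id[of V] permutes_id[of C] by blast
    show "f i \<subseteq> X \<and> card (f i) < 2 ^ m" if i: "i \<in> I" for i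
    proof -
      have "card (f i) \<le> card (vertex_pairs n)"
      proof (rule card_inj_on_le)
        show "inj_on fst (f i)" by (rule inj_onI) (auto simp: f_def colored_copy_def)
        show "fst ` f i \<subseteq> vertex_pairs n" using subX[OF i] by (auto simp: X_def)
      qed (rule finite_vertex_pairs)
      then have "card (f i) < 2 ^ m" using card_vertex_pairs_le[of n] m(2) by linarith
      then show ?thesis using subX[OF i] by simp
    qed
    fix T assume T: "T \<subseteq> X"
    have n: "card V = n" "card C = c" by (auto simp: V_def C_def)
    have "V \<noteq> {}" "C \<noteq> {}" using pos c by (auto simp: V_def C_def)
    moreover have "finite V" "finite C" by (auto simp: V_def C_def)
    moreover have "finite T" using T finX by (rule finite_subset)
    ultimately show "real (card {i\<in>I. T \<subseteq> f i}) \<le> \<theta> ^ card T * card I"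
      unfolding f_def I_def \<theta>_def \<beta>_def x_def n(1)[symmetric] n(2)[symmetric] using pos \<beta> lab
      by (intro colored_copy_spread E deg dens) (auto simp: n \<beta>_def)
  qed
  also have "miss_prob q X m (f ` I) = bin_expect (1 - (1 - q) ^ m) X g"
    unfolding g_def by (rule miss_prob_eq[OF finX])
  finally have bound: "bin_expect (1 - (1 - q) ^ m) X g \<le> 4 * real m / L" .
  have "measure_pmf.expectation (colored_subset c p (vertex_pairs n)) g \<le> bin_expect (1 - (1 - q) ^ m) X g"
    unfolding g_def X_def C_def
  proof (rule colored_subset_miss_le[OF finite_vertex_pairs c(1) p])
    show "0 \<le> 1 - (1 - q) ^ m" using q0 q1 by (simp add: power_le_one)
    \<comment> \<open>The union of the \<open>m\<close> rounds has density at most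
      \<open>m * q\<close>.\<close>
    have "1 + real m * (- q) \<le> (1 + (- q)) ^ m" using q1 by (intro Bernoulli_inequality) auto
    then show "1 - (1 - q) ^ m \<le> p / c" using mq by simp
    show "S \<subseteq> vertex_pairs n \<times> {1..c}" if "S \<in> f ` I" for S
      using that subX by (auto simp: X_def C_def)
  qed (rule single)
  with bound have E_le: "measure_pmf.expectation (colored_subset c p (vertex_pairs n)) g \<le> 4 * real m / L"
    by linarith
  let ?D = "random_colored_graph c n p"
  let ?A = "{G. contains_rainbow_copy H G}"
  let ?\<Phi> = "\<lambda>(G, col). {(e, col e) | e. e \<in> edges G} :: (nat set \<times> nat) set"
  have "1 - measure_pmf.prob ?D ?A = measure_pmf.prob ?D (- ?A)"
    using measure_pmf.prob_compl[of ?A ?D] by (simp add: Compl_eq_Diff_UNIV)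
  also have "\<dots> = measure_pmf.expectation ?D (indicator (- ?A))" by simp
  \<comment> \<open>One direction suffices: a contained \<open>colored_copy\<close> yields a rainbow
    copy.\<close>
  also have "\<dots> \<le> measure_pmf.expectation ?D (\<lambda>y. g (?\<Phi> y))"
  proof (rule integral_mono_AE)
    show "integrable (measure_pmf ?D) (indicator (- ?A) :: _ \<Rightarrow> real)"
      by (rule measure_pmf.integrable_const_bound[of _ 1]) (auto simp: indicator_def)
    show "integrable (measure_pmf ?D) (\<lambda>y. g (?\<Phi> y))"
      by (rule measure_pmf.integrable_const_bound[of _ 1]) (auto simp: g_def)
    show "AE y in measure_pmf ?D. indicator (- ?A) y \<le> g (?\<Phi> y)"
    proof (rule AE_pmfI)
      fix y assume y: "y \<in> set_pmf ?D"
      have "contains_rainbow_copy H y" if i: "i \<in> I" "f i \<subseteq> ?\<Phi> y" for i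
      proof -
        have "contains_rainbow_copy H (fst y, snd y)"
          using i random_colored_graph_support[OF y]
          by (intro colored_copy_rainbow[OF b _ _ _ E_def E lab, of "fst i" "snd i"])
            (auto simp: I_def f_def V_def case_prod_unfold)
        then show ?thesis by simp
      qed
      then show "indicator (- ?A) y \<le> g (?\<Phi> y)" by (auto simp: g_def indicator_def)
    qed
  qed
  also have "\<dots> = measure_pmf.expectation (colored_subset c p (vertex_pairs n)) g"
    by (simp flip: map_random_colored_graph)
  finally show ?thesis using E_le by linarith
qed

section \<open>Asymptotics\<close>

text \<open>The factor 3 comes from \<open>ln 2 \<ge> 2 / 3\<close>; the summand 1 makes the
  inequality strict.\<close>

lemma rounds_suffice:
  assumes "n > 0"
  shows "n\<^sup>2 < 2 ^ (nat \<lceil>3 * ln (real n)\<rceil> + 1)"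
proof -
  have l: "ln (real n) \<ge> 0" using assms by simp
  have "real n ^ 2 = exp (2 * ln (real n))" using assms by (simp add: exp_of_nat_mult[of 2, simplified])
  also have "\<dots> \<le> exp (3 * ln (real n) * ln 2)"
    using mult_right_mono[OF ln2_ge_two_thirds l] by (simp add: mult_ac)
  also have "\<dots> = 2 powr (3 * ln (real n))" by (simp add: powr_def)
  also have "\<dots> \<le> 2 powr real (nat \<lceil>3 * ln (real n)\<rceil>)"
    by (intro powr_mono real_nat_ceiling_ge) auto
  also have "\<dots> = 2 ^ nat \<lceil>3 * ln (real n)\<rceil>" by (simp add: powr_realpow)
  also have "\<dots> < 2 ^ (nat \<lceil>3 * ln (real n)\<rceil> + 1)" by simp
  finally have "real (n\<^sup>2) < real (2 ^ (nat \<lceil>3 * ln (real n)\<rceil> + 1))" by simp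
  then show ?thesis by (simp only: of_nat_less_iff)
qed

text \<open>Up to a constant this bounds the failure probability \<open>4 * m / L\<close>; the
  square arises because \<open>L\<close> itself has \<open>m\<close> in its denominator. For
  \<open>d = 1\<close> the powers of \<open>n\<close> cancel and the logarithms decide; otherwise a
  factor n^(-1/(3d)) is left.\<close>

lemma log_factors_vanish:
  fixes d :: nat and x :: real
  assumes "d > 0" "x = (if d = 1 then 1 else 4 / (3 * real d))"
  shows "(\<lambda>n. (3 * ln (real n) + 2)\<^sup>2 * real n powr (- x) /
    (real n powr (- 1 / real d) * ln (real n) powr (5 / real d))) \<longlonglongrightarrow> 0"
proof (cases "d = 1")
  case True
  have "(\<lambda>n. (3 * ln (real n) + 2)\<^sup>2 * real n powr (- 1) /
    (real n powr (- 1) * ln (real n) powr 5)) \<longlonglongrightarrow> 0" by real_asymp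
  then show ?thesis using True assms by simp
next
  case False
  define y where "y = 1 / real d"
  have y: "y > 0" using assms by (simp add: y_def)
  have "(\<lambda>n. (3 * ln (real n) + 2)\<^sup>2 * real n powr (- (4 / 3 * y)) /
    (real n powr (- y) * ln (real n) powr (5 * y))) \<longlonglongrightarrow> 0" using y by real_asymp
  then show ?thesis using False assms by (simp add: y_def)
qed

theorem theorem1p4:
  fixes \<alpha> :: real and \<Delta> d :: nat
    and H :: "nat \<Rightarrow> 'a graph" and c :: "nat \<Rightarrow> nat" and p :: "nat \<Rightarrow> real"
  assumes "\<alpha> > 0" and "\<Delta> > 0" and "d > 0"
    and "\<forall>\<^sub>F n in sequentially. H n \<in> graph_family n \<Delta> (real d) \<and> edges (H n) \<noteq> {}"
    and "\<forall>\<^sub>F n in sequentially. c n = nat \<lceil>(1 + \<alpha>) * real (card (edges (H n)))\<rceil>"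
    and "\<forall>\<^sub>F n in sequentially. 0 \<le> p n \<and> p n \<le> 1 \<and>
           p n \<ge> real n powr (- 1 / real d) * ln (real n) powr (5 / real d)"
  shows "(\<lambda>n. measure_pmf.prob (random_colored_graph (c n) n (p n))
           {G. contains_rainbow_copy (H n) G}) \<longlonglongrightarrow> 1"
proof -
  define x where "x = (if d = 1 then 1 else 4 / (3 * real d))"
  define p0 where "p0 n = real n powr (- 1 / real d) * ln (real n) powr (5 / real d)" for n
  define \<beta> where "\<beta> n = real \<Delta> * exp 2 / real n" for n
  define m where "m n = nat \<lceil>3 * ln (real n)\<rceil> + 1" for n
  \<comment> \<open>The largest value that the last assumption of
    \<open>prob_rainbow_copy_ge\<close> permits for the edge probability
    \<open>p0 n\<close>.\<close>
  define L where "L n = p0 n / (real (m n) * exp 1 * \<beta> n powr x)" for n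
  define K where "K = 4 * exp 1 * (real \<Delta> * exp 2) powr x"
  define r where "r n = (3 * ln (real n) + 2)\<^sup>2 * real n powr (- x) / p0 n" for n
  let ?P = "\<lambda>n. measure_pmf.prob (random_colored_graph (c n) n (p n)) {G. contains_rainbow_copy (H n) G}"
  have "r \<longlonglongrightarrow> 0"
    unfolding r_def p0_def using log_factors_vanish[OF assms(3) x_def] by simp
  then have lim: "(\<lambda>n. K * r n) \<longlonglongrightarrow> 0" using tendsto_mult_right_zero by blast
  have "\<forall>\<^sub>F n in sequentially. K * r n < 1" using lim by (rule order_tendstoD) simp
  moreover have "\<forall>\<^sub>F n in sequentially. \<beta> n < 1"
  proof -
    have "\<beta> \<longlonglongrightarrow> 0" unfolding \<beta>_def by real_asymp
    then show ?thesis by (rule order_tendstoD) simp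
  qed
  ultimately have ev: "\<forall>\<^sub>F n in sequentially. 1 - K * r n \<le> ?P n"
    using assms(4,5,6) eventually_ge_at_top[of 2]
  proof eventually_elim
    case (elim n)
    have n: "real n \<ge> 2" "n > 0" and ln0: "ln (real n) > 0" using elim(6) by auto
    have p0: "p0 n > 0" using n ln0 by (simp add: p0_def)
    have \<beta>0: "\<beta> n > 0" using n assms(2) by (simp add: \<beta>_def)
    have m1: "real (m n) \<ge> 1" "m n > 0" by (auto simp: m_def)
    have L0: "L n > 0" using p0 m1 \<beta>0 by (simp add: L_def)
    have m_le: "real (m n) \<le> 3 * ln (real n) + 2" using ln0 unfolding m_def by linarith
    have "4 * real (m n) / L n = 4 * exp 1 * \<beta> n powr x * (real (m n))\<^sup>2 / p0 n"
      using p0 m1 \<beta>0 by (simp add: L_def field_simps power2_eq_square)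
    also have "\<dots> \<le> 4 * exp 1 * \<beta> n powr x * (3 * ln (real n) + 2)\<^sup>2 / p0 n"
      using m_le m1 p0 by (intro divide_right_mono mult_left_mono power_mono) auto
    also have "\<dots> = K * r n"
    proof -
      have "\<beta> n powr x = (real \<Delta> * exp 2) powr x * real n powr (- x)"
        unfolding \<beta>_def using n by (simp add: powr_divide powr_minus_divide)
      then show ?thesis by (simp add: K_def r_def)
    qed
    finally have fail: "4 * real (m n) / L n \<le> K * r n" .
    \<comment> \<open>The condition \<open>L n \<ge> 4\<close> is read off from the failure bound
      itself, once that is below 1.\<close>
    then have "4 * real (m n) / L n \<le> 1" using elim(1) by linarith
    then have "4 * real (m n) \<le> L n" using L0 by (simp add: field_simps)
    then have L4: "L n \<ge> 4" using m1 by linarith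
    have finE: "finite (edges (H n))"
    proof (rule finite_subset)
      show "edges (H n) \<subseteq> Pow (verts (H n))" "finite (Pow (verts (H n)))"
        using elim(3) by (auto simp: graph_family_def simple_graph_def)
    qed
    then have E0: "card (edges (H n)) > 0" using elim(3) by (simp add: card_gt_0_iff)
    have "1 * real (card (edges (H n))) \<le> (1 + \<alpha>) * real (card (edges (H n)))"
      using assms(1) by (intro mult_right_mono) auto
    then have c: "card (edges (H n)) \<le> c n" using elim(4) by linarith
    have "1 - 4 * real (m n) / L n \<le> ?P n"
    proof (rule prob_rainbow_copy_ge)
      show "H n \<in> graph_family n \<Delta> (real d)" "p n \<le> 1" using elim by auto
      show "c n > 0" "card (edges (H n)) \<le> c n" using c E0 by auto
      show "real \<Delta> * exp 2 / real n \<le> 1" using elim(2) by (simp add: \<beta>_def)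
      show "n\<^sup>2 < 2 ^ m n" unfolding m_def using n(2) by (rule rounds_suffice)
      have "real (m n) * L n * exp 1 * \<beta> n powr x = p0 n"
        using m1 \<beta>0 by (simp add: L_def)
      also have "p0 n \<le> p n" using elim(5) by (simp add: p0_def)
      finally show "real (m n) * L n * exp 1 *
          (real \<Delta> * exp 2 / real n) powr (if d = 1 then 1 else 4 / (3 * real d)) \<le> p n"
        by (simp add: \<beta>_def x_def)
    qed (use assms n L4 m1 in auto)
    then show ?case using fail by linarith
  qed
  show ?thesis
  proof (rule tendsto_sandwich[OF ev])
    show "\<forall>\<^sub>F n in sequentially. ?P n \<le> 1" by simp
    show "(\<lambda>n. 1 - K * r n) \<longlonglongrightarrow> 1" using tendsto_diff[OF tendsto_const lim, of 1] by simp
  qed simp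
qed

end
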